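(* Let $\Sigma$ be a $d$-dimensional shifted simplicial complex and $0\le i\le d$. Every nonzero element of $\mathbf S^{ud}_{i-1}(\Sigma)$ is of the form $\uparrow^{d-i}z(S,T)$ for finite multisets $S,T$ of integers, and $\mathbf S^{ud}_{i-1}(\Sigma)$ is determined recursively as follows. If $\Sigma$ has no vertices, $\mathbf S^{ud}_{i-1}(\Sigma)$ has no nonzero elements. Otherwise, let $p$ be the initial vertex of the pure skeleton $\Sigma_{[i]}$, $\Delta=\mathrm{del}_p\Sigma_{[i]}$, $\Lambda=\mathrm{link}_p\Sigma_{[i]}$, and write $\tilde S=S\cup\{p\}$, $\tilde T=T\cup\{p\}$; then the nonzero elements of $\mathbf S^{ud}_{i-1}(\Delta)$ and $\mathbf S^{ud}_{i-2}(\Lambda)$ are of the form $z(S,T)$, and $$\mathbf S^{ud}_{i-1}(\Sigma)\overset\circ=\{\uparrow^{d-i}z(S,\tilde T):0\ne z(S,T)\in\mathbf S^{ud}_{i-1}(\Delta)\}\cup\{\uparrow^{d-i}z(\tilde S,\tilde T):0\neq z(S,T)\in\mathbf S^{ud}_{i-2}(\Lambda)\}\cup\{\uparrow^{d-i}z(\emptyset,\{p\})\}^{\beta_{i-1}(\Delta)}.$$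
   Context: Shifted complex: simplicial complex on vertex set an integer interval $[p,q]$ such that $i<j$, $F\in\Sigma$, $i\notin F$, $j\in F$ imply $(F\setminus\{j\})\cup\{i\}\in\Sigma$; its initial vertex is its smallest vertex. The pure $i$-skeleton $\Sigma_{[i]}$ is the subcomplex generated by the $i$-dimensional faces. $\mathrm{del}_p\Sigma=\{F\in\Sigma:p\notin F\}$, $\mathrm{link}_p\Sigma=\{F:p\notin F,F\cup\{p\}\in\Sigma\}$. $\Bbbk$ = rational functions over $\mathbb C$ in $x_{a,j}$, $X_{a,j}=x_{a,j}^2$; for a multiset $S=\{i_1\le\dots\le i_m\}$, $x_S=x_{1,i_1}\cdots x_{m,i_m}$, $X_S=x_S^2$, $x_\emptyset=1$; $\uparrow$ substitutes $x_{a,j}\mapsto x_{a+1,j}$. $z(S,T)=\frac{1}{\uparrow X_S}\sum_{j\in T}X_{S\cup j}$ (multiset unions). For a complex $\Omega$ of dimension $e$, $C_i(\Omega)$ has basis $[F]$ for $i$-faces (with $[\emptyset]$ in degree $-1$), $\varepsilon(j,F)=(-1)^{k+1}$ if $j$ is the $k$-th smallest element of $F$, $\boldsymbol\partial_{\Omega,i}[F]=\sum_{j\in F}\varepsilon(j,F)\frac{\uparrow^{e-i}(x_F)}{\uparrow^{e-i+1}(x_{F\setminus j})}[F\setminus j]$, $\mathbf L^{ud}_{\Omega,i}=\boldsymbol\partial_{\Omega,i+1}\boldsymbol\partial^T_{\Omega,i+1}$, and $\mathbf S^{ud}_i(\Omega)$ is its multiset of eigenvalues (each complex weighted with its own dimension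 $e$; empty if there are no $i$-faces). $\overset\circ=$ means multiset equality up to the multiplicity of $0$; $\cup$ adds multiplicities; $\beta_i$ = rank of $\tilde H_i(\cdot;\mathbb Z)$. *)

theory Defs
  imports
    "HOL-Algebra.Algebraic_Closure_Type"
    "HOL-Algebra.Free_Abelian_Groups"
    "HOL-Library.Poly_Mapping"
    "HOL-Computational_Algebra.Fraction_Field"
    "Jordan_Normal_Form.Char_Poly"
begin

section \<open>The field of weights\<close>

text \<open>A separate type of indeterminates carries the linear order which the \<^class>\<open>idom\<close> instance of
  \<^type>\<open>poly_mapping\<close> asks for. \<open>XVar a j\<close> is the indeterminate $x_{a,j}$.\<close>

datatype xvar = XVar nat int

instantiation xvar :: linorder
begin

fun less_eq_xvar :: "xvar \<Rightarrow> xvar \<Rightarrow> bool" where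
  "XVar a i \<le> XVar b j \<longleftrightarrow> a < b \<or> (a = b \<and> i \<le> j)"

definition less_xvar :: "xvar \<Rightarrow> xvar \<Rightarrow> bool" where
  "less_xvar u v \<longleftrightarrow> u \<le> v \<and> \<not> v \<le> u"

instance
proof
  fix u v w :: xvar
  show "u < v \<longleftrightarrow> u \<le> v \<and> \<not> v \<le> u" by (fact less_xvar_def)
  show "u \<le> u" by (cases u) simp
  show "u \<le> v \<Longrightarrow> v \<le> w \<Longrightarrow> u \<le> w" by (cases u; cases v; cases w) auto
  show "u \<le> v \<Longrightarrow> v \<le> u \<Longrightarrow> u = v" by (cases u; cases v) auto
  show "u \<le> v \<or> v \<le> u" by (cases u; cases v) auto
qed

end

type_synonym mono = "xvar \<Rightarrow>\<^sub>0 nat"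
type_synonym cpoly = "mono \<Rightarrow>\<^sub>0 complex"
type_synonym ratfun = "cpoly fract"

definition xv :: "nat \<Rightarrow> int \<Rightarrow> ratfun" where
  "xv a j = Fract (Poly_Mapping.single (Poly_Mapping.single (XVar a j) 1) 1) 1"

subsection \<open>The substitution raising the first index\<close>

text \<open>Reindexing of a finitely supported function. On exponent vectors it renames the variables;
  on polynomials it renames the monomials.\<close>

definition push :: "('a \<Rightarrow> 'b) \<Rightarrow> ('a \<Rightarrow>\<^sub>0 'c) \<Rightarrow> ('b \<Rightarrow>\<^sub>0 'c::comm_monoid_add)" where
  "push f p = (\<Sum>k\<in>Poly_Mapping.keys p. Poly_Mapping.single (f k) (Poly_Mapping.lookup p k))"

lemma push_superset:
  assumes "finite A" "Poly_Mapping.keys p \<subseteq> A"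
  shows "push f p = (\<Sum>k\<in>A. Poly_Mapping.single (f k) (Poly_Mapping.lookup p k))"
  unfolding push_def using assms by (intro sum.mono_neutral_left) (auto simp: in_keys_iff)

lemma push_zero [simp]: "push f 0 = 0"
  by (simp add: push_def)

lemma push_single [simp]: "push f (Poly_Mapping.single k c) = Poly_Mapping.single (f k) c"
  by (simp add: push_def)

lemma push_add: "push f (p + q) = push f p + push f q"
proof -
  let ?A = "Poly_Mapping.keys p \<union> Poly_Mapping.keys q"
  have "push f (p + q) = (\<Sum>k\<in>?A. Poly_Mapping.single (f k) (Poly_Mapping.lookup (p + q) k))"
    by (rule push_superset) (use Poly_Mapping.keys_add[of p q] in auto)
  also have "\<dots> = (\<Sum>k\<in>?A. Poly_Mapping.single (f k) (Poly_Mapping.lookup p k))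
      + (\<Sum>k\<in>?A. Poly_Mapping.single (f k) (Poly_Mapping.lookup q k))"
    by (simp add: lookup_add single_add sum.distrib)
  also have "\<dots> = push f p + push f q"
    by (simp add: push_superset[of ?A])
  finally show ?thesis .
qed

lemma push_sum: "push f (\<Sum>i\<in>I. g i) = (\<Sum>i\<in>I. push f (g i))"
  by (induction I rule: infinite_finite_induct) (auto simp: push_add)

lemma push_id: "(\<Sum>k\<in>Poly_Mapping.keys p. Poly_Mapping.single k (Poly_Mapping.lookup p k)) = p"
  by (rule poly_mapping_eqI) (auto simp: lookup_sum lookup_single when_def in_keys_iff)

lemma push_mult:
  fixes p q :: "'a::monoid_add \<Rightarrow>\<^sub>0 'c::semiring_0"
  assumes f: "\<And>k l. f (k + l) = f k + f l"
  shows "push f (p * q) = push f p * push f q"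
proof -
  have "p * q = (\<Sum>k\<in>Poly_Mapping.keys p. \<Sum>l\<in>Poly_Mapping.keys q.
      Poly_Mapping.single (k + l) (Poly_Mapping.lookup p k * Poly_Mapping.lookup q l))"
    by (subst (1) push_id[of p, symmetric], subst (1) push_id[of q, symmetric])
      (simp add: sum_product mult_single)
  then show ?thesis
    by (simp add: push_sum f) (simp add: push_def sum_product mult_single)
qed

lemma lookup_push:
  assumes "inj f"
  shows "Poly_Mapping.lookup (push f p) (f k) = Poly_Mapping.lookup p k"
  using assms by (auto simp: push_def lookup_sum lookup_single when_def inj_eq in_keys_iff)

lemma inj_push: "inj f \<Longrightarrow> inj (push f)"
  by (intro injI poly_mapping_eqI) (metis lookup_push)

primrec shift_var :: "xvar \<Rightarrow> xvar" where
  "shift_var (XVar a j) = XVar (a + 1) j"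

lemma inj_shift_var: "inj shift_var"
proof (rule injI)
  show "u = v" if "shift_var u = shift_var v" for u v using that by (cases u; cases v) simp
qed

definition up_poly :: "cpoly \<Rightarrow> cpoly" where
  "up_poly = push (push shift_var)"

lemma up_poly_0 [simp]: "up_poly 0 = 0"
  and up_poly_add: "up_poly (p + q) = up_poly p + up_poly q"
  and up_poly_mult: "up_poly (p * q) = up_poly p * up_poly q"
  and inj_up_poly: "inj up_poly"
  by (simp_all add: up_poly_def push_add push_mult inj_push inj_shift_var)

lemma up_poly_1 [simp]: "up_poly 1 = 1"
  by (simp add: up_poly_def flip: single_one)

lemma up_poly_eq_0 [simp]: "up_poly p = 0 \<longleftrightarrow> p = 0"
  using inj_up_poly by (metis injD up_poly_0)

definition uparrow :: "ratfun \<Rightarrow> ratfun" where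
  "uparrow r = (THE s. \<forall>p q. q \<noteq> 0 \<longrightarrow> r = Fract p q \<longrightarrow> s = Fract (up_poly p) (up_poly q))"

lemma uparrow_Fract:
  assumes "q \<noteq> 0"
  shows "uparrow (Fract p q) = Fract (up_poly p) (up_poly q)"
proof -
  have "Fract (up_poly p) (up_poly q) = Fract (up_poly p') (up_poly q')"
    if "q' \<noteq> 0" "Fract p q = Fract p' q'" for p' q'
    using that assms by (simp add: eq_fract flip: up_poly_mult)
  then show ?thesis
    unfolding uparrow_def
    by (intro the_equality allI impI) (assumption, use assms in blast)
qed

lemma uparrow_xv: "uparrow (xv a j) = xv (a + 1) j"
  by (simp add: xv_def uparrow_Fract) (simp add: up_poly_def)

lemma uparrow_const: "uparrow (Fract (Poly_Mapping.single 0 c) 1) = Fract (Poly_Mapping.single 0 c) 1"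
  by (simp add: uparrow_Fract) (simp add: up_poly_def)

lemma uparrow_add: "uparrow (r + s) = uparrow r + uparrow s"
  by (cases r; cases s) (simp add: uparrow_Fract up_poly_add up_poly_mult)

lemma uparrow_mult: "uparrow (r * s) = uparrow r * uparrow s"
  by (cases r; cases s) (simp add: uparrow_Fract up_poly_mult)

subsection \<open>Monomials and z-polynomials\<close>

text \<open>The indices \<open>a\<close> of $x_{a,j}$ start at 1, list positions at 0.\<close>

definition xm :: "int multiset \<Rightarrow> ratfun" where
  "xm S = (\<Prod>k<size S. xv (k + 1) (sorted_list_of_multiset S ! k))"

definition Xm :: "int multiset \<Rightarrow> ratfun" where
  "Xm S = (xm S)\<^sup>2"

definition zpoly :: "int multiset \<Rightarrow> int multiset \<Rightarrow> ratfun" where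
  "zpoly S T = 1 / uparrow (Xm S) * (\<Sum>j\<in>#T. Xm (add_mset j S))"


section \<open>Simplicial complexes\<close>

definition simplicial_complex :: "int set set \<Rightarrow> bool" where
  "simplicial_complex \<Omega> \<longleftrightarrow>
     {} \<in> \<Omega> \<and> (\<forall>F\<in>\<Omega>. finite F) \<and> (\<forall>F\<in>\<Omega>. \<forall>G. G \<subseteq> F \<longrightarrow> G \<in> \<Omega>)"

definition vertices :: "int set set \<Rightarrow> int set" where
  "vertices \<Omega> = {v. {v} \<in> \<Omega>}"

definition shifted_complex :: "int set set \<Rightarrow> bool" where
  "shifted_complex \<Omega> \<longleftrightarrow> simplicial_complex \<Omega> \<and>
     (\<exists>p q. vertices \<Omega> = {p..q} \<and>
        (\<forall>i\<in>{p..q}. \<forall>j\<in>{p..q}. \<forall>F\<in>\<Omega>.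
           i < j \<longrightarrow> i \<notin> F \<longrightarrow> j \<in> F \<longrightarrow> (F - {j}) \<union> {i} \<in> \<Omega>))"

text \<open>Dimensions are integers, since the empty face has dimension \<open>-1\<close>.\<close>

definition faces :: "int set set \<Rightarrow> int \<Rightarrow> int set set" where
  "faces \<Omega> i = {F \<in> \<Omega>. int (card F) - 1 = i}"

definition cdim :: "int set set \<Rightarrow> int" where
  "cdim \<Omega> = Max ((\<lambda>F. int (card F) - 1) ` \<Omega>)"

definition pure_skel :: "int set set \<Rightarrow> int \<Rightarrow> int set set" where
  "pure_skel \<Omega> i = {F. \<exists>G\<in>faces \<Omega> i. F \<subseteq> G}"

definition del :: "int \<Rightarrow> int set set \<Rightarrow> int set set" where
  "del p \<Omega> = {F \<in> \<Omega>. p \<notin> F}"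

definition link :: "int \<Rightarrow> int set set \<Rightarrow> int set set" where
  "link p \<Omega> = {F. p \<notin> F \<and> F \<union> {p} \<in> \<Omega>}"

definition initial_vertex :: "int set set \<Rightarrow> int" where
  "initial_vertex \<Omega> = Min (vertices \<Omega>)"

text \<open>\<open>j\<close> is the \<open>k\<close>-th smallest element of \<open>F\<close> for \<open>k = card {l \<in> F. l \<le> j}\<close>.\<close>

definition eps :: "int \<Rightarrow> int set \<Rightarrow> int" where
  "eps j F = (-1) ^ (card {l \<in> F. l \<le> j} + 1)"


section \<open>The weighted up-down Laplacian and its spectrum\<close>

text \<open>The matrices are taken in the bases \<open>[F]\<close>, listed in a fixed but arbitrary order; the
  spectrum does not depend on the order.\<close>

definition face_list :: "int set set \<Rightarrow> int \<Rightarrow> int set list" where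
  "face_list \<Omega> i = (SOME Fs. distinct Fs \<and> set Fs = faces \<Omega> i)"

text \<open>Coefficient of \<open>[G]\<close> in the boundary of \<open>[F]\<close>. If \<open>F\<close> is an \<open>i\<close>-face then \<open>i \<le> cdim \<Omega>\<close>,
  so the truncation by \<^const>\<open>nat\<close> has no effect.\<close>

definition bdry_coeff :: "int set set \<Rightarrow> int \<Rightarrow> int set \<Rightarrow> int set \<Rightarrow> ratfun" where
  "bdry_coeff \<Omega> i G F =
     (\<Sum>j | j \<in> F \<and> F - {j} = G.
        of_int (eps j F) * ((uparrow ^^ nat (cdim \<Omega> - i)) (xm (mset_set F))
                            / (uparrow ^^ nat (cdim \<Omega> - i + 1)) (xm (mset_set (F - {j})))))"

definition bdry_mat :: "int set set \<Rightarrow> int \<Rightarrow> ratfun mat" where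
  "bdry_mat \<Omega> i =
     mat (length (face_list \<Omega> (i - 1))) (length (face_list \<Omega> i))
       (\<lambda>(r, c). bdry_coeff \<Omega> i (face_list \<Omega> (i - 1) ! r) (face_list \<Omega> i ! c))"

definition Lud :: "int set set \<Rightarrow> int \<Rightarrow> ratfun mat" where
  "Lud \<Omega> i = bdry_mat \<Omega> (i + 1) * transpose_mat (bdry_mat \<Omega> (i + 1))"

text \<open>Eigenvalues with algebraic multiplicity, in an algebraic closure of the field of rational
  functions, so that the matrix has as many of them as it has rows. \<^const>\<open>to_ac\<close> is the embedding.\<close>

definition Sud :: "int set set \<Rightarrow> int \<Rightarrow> ratfun alg_closure multiset" where
  "Sud \<Omega> i = proots (char_poly (map_mat to_ac (Lud \<Omega> i)))"

definition nonzero_part :: "'a::zero multiset \<Rightarrow> 'a multiset" where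
  "nonzero_part M = filter_mset (\<lambda>x. x \<noteq> 0) M"

definition eq_upto_zero :: "'a::zero multiset \<Rightarrow> 'a multiset \<Rightarrow> bool" (infix \<open>\<doteq>\<^sub>0\<close> 50) where
  "M \<doteq>\<^sub>0 N \<longleftrightarrow> nonzero_part M = nonzero_part N"

definition z_ev :: "nat \<Rightarrow> int multiset \<Rightarrow> int multiset \<Rightarrow> ratfun alg_closure" where
  "z_ev n S T = to_ac ((uparrow ^^ n) (zpoly S T))"


section \<open>Reduced integral homology\<close>

definition bdry_chain :: "(int set \<Rightarrow>\<^sub>0 int) \<Rightarrow> (int set \<Rightarrow>\<^sub>0 int)" where
  "bdry_chain = frag_extend (\<lambda>F. \<Sum>j\<in>F. frag_cmul (eps j F) (frag_of (F - {j})))"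

definition cycle_group :: "int set set \<Rightarrow> int \<Rightarrow> (int set \<Rightarrow>\<^sub>0 int) monoid" where
  "cycle_group \<Omega> k = subgroup_generated (free_Abelian_group (faces \<Omega> k))
     {c \<in> carrier (free_Abelian_group (faces \<Omega> k)). bdry_chain c = 0}"

definition boundaries :: "int set set \<Rightarrow> int \<Rightarrow> (int set \<Rightarrow>\<^sub>0 int) set" where
  "boundaries \<Omega> k = bdry_chain ` carrier (free_Abelian_group (faces \<Omega> (k + 1)))"

definition reduced_homology :: "int set set \<Rightarrow> int \<Rightarrow> (int set \<Rightarrow>\<^sub>0 int) set monoid" where
  "reduced_homology \<Omega> k = cycle_group \<Omega> k Mod boundaries \<Omega> k"

text \<open>The rank of an abelian group: the largest size of a \<open>\<int>\<close>-linearly independent subset.\<close>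

definition abelian_rank :: "('a, 'b) monoid_scheme \<Rightarrow> nat" where
  "abelian_rank G = Sup {card B | B. finite B \<and> B \<subseteq> carrier G \<and>
     (\<forall>c::'a \<Rightarrow> int. finprod G (\<lambda>b. b [^]\<^bsub>G\<^esub> c b) B = \<one>\<^bsub>G\<^esub> \<longrightarrow> (\<forall>b\<in>B. c b = 0))}"

definition betti :: "int set set \<Rightarrow> int \<Rightarrow> nat" where
  "betti \<Omega> k = abelian_rank (reduced_homology \<Omega> k)"

end

theory Submission
  imports Defs
begin

text \<open>Let \<open>\<F>\<close> be the set of \<open>i\<close>-faces and \<open>p\<close> the initial vertex. Listing the ridges without \<open>p\<close>
  first, and likewise the faces, the weighted boundary matrix has the block rows $(A, a I)$ and
  $(0, -c {\uparrow}B)$ with $a = x_{1,p}$ and $c = x_{1,p}/x_{2,p}$, where $A$ and $B$ are the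
  boundary matrices of the deletion and of the link; by shiftedness the ridges without \<open>p\<close> are exactly the maximal faces of the link. As
  $({\uparrow}B) A = 0$, the characteristic polynomial of the Laplacian splits, so an eigenvalue $v$ of
  the deletion becomes $a^2 + v$, an eigenvalue $w$ of the link becomes $a^2 + c^2{\uparrow}w$, and
  the remaining ones are $a^2$. These are the identities for $z(S, T \cup p)$,
  $z(S \cup p, T \cup p)$ and $z(\emptyset, p)$. Counting faces through $p + 1$ shows that the
  number of the remaining ones is the number of $(i-1)$-faces $G$ of the deletion without $p + 1$
  for which $G \cup \{p + 1\}$ is not a face, and restricting a cycle to these faces identifies the
  homology with the free abelian group on them. Finally, in an arbitrary representation of an eigenvalue
  as $z(S,T)$, the multisets $S$ and $T$ lie above $p$, as the variables $x_{1,j}$ show.\<close>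

section \<open>Characteristic polynomials of block matrices\<close>

text \<open>The blocks are this simple because of the weights. A new least element p multiplies
  \<open>xm\<close> by \<open>xv 1 p\<close> and moves all other entries one place on, so the
  coefficient from p \<union> G to G is the scalar a for every G, while the one from p \<union> G to
  p \<union> H is the shifted link coefficient times -c. The shift also makes the weights telescope
  in a product of consecutive boundary matrices, so that boundary squared zero survives the
  weighting.

  The obstacle is the multiplicity of 0. A zero eigenvalue of the deletion or of the link turns into
  a^2, which is no longer zero, so the recursion can be stated up to zeros only if the nonzero
  eigenvalues are counted exactly. This count, the number of faces containing the least admissible
  vertex, is therefore part of the induction. It determines how often a^2 occurs, as a number of
  faces; the homology is computed separately and gives the same number.\<close>

definition chr :: "'a::idom \<Rightarrow> 'a mat \<Rightarrow> 'a" where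
  "chr x M = det (x \<cdot>\<^sub>m 1\<^sub>m (dim_row M) - M)"

text \<open>Sylvester's identity, free of division: the lower left block C of P is cleared by
  columns with U, of determinant 1, or by rows with L, of determinant x^m, and the two triangular
  results are compared.\<close>

lemma chr_mult_commute:
  fixes x :: "'a::idom"
  assumes B: "B \<in> carrier_mat n m" and C: "C \<in> carrier_mat m n"
  shows "x ^ m * chr x (B * C) = x ^ n * chr x (C * B)"
proof -
  define P where "P = four_block_mat (x \<cdot>\<^sub>m 1\<^sub>m n) B C (1\<^sub>m m)"
  define U where "U = four_block_mat (1\<^sub>m n) (0\<^sub>m n m) (- C) (1\<^sub>m m)"
  define L where "L = four_block_mat (1\<^sub>m n) (0\<^sub>m n m) (- C) (x \<cdot>\<^sub>m 1\<^sub>m m)"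
  have carr: "P \<in> carrier_mat (n + m) (n + m)" "U \<in> carrier_mat (n + m) (n + m)"
    "L \<in> carrier_mat (n + m) (n + m)"
    using B C by (auto simp: P_def U_def L_def)
  have "P * U = four_block_mat (x \<cdot>\<^sub>m 1\<^sub>m n - B * C) B (0\<^sub>m m n) (1\<^sub>m m)"
    unfolding P_def U_def using B C
    by (subst mult_four_block_mat[of _ n n _ m _ m _ _ n _ m])
      (auto intro!: arg_cong4[where f=four_block_mat])
  then have "det P * det U = det (four_block_mat (x \<cdot>\<^sub>m 1\<^sub>m n - B * C) B (0\<^sub>m m n) (1\<^sub>m m))"
    using det_mult[OF carr(1,2)] by simp
  also have "\<dots> = chr x (B * C)"
    using B C by (subst det_four_block_mat_lower_left_zero[of _ n _ m]) (auto simp: chr_def)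
  also have "det U = 1"
    unfolding U_def using C by (subst det_four_block_mat_upper_right_zero[of _ n _ m]) auto
  finally have 1: "det P = chr x (B * C)" by simp
  have "L * P = four_block_mat (x \<cdot>\<^sub>m 1\<^sub>m n) B (0\<^sub>m m n) (x \<cdot>\<^sub>m 1\<^sub>m m - C * B)"
    unfolding P_def L_def using B C
    by (subst mult_four_block_mat[of _ n n _ m _ m _ _ n _ m])
      (auto intro!: arg_cong4[where f=four_block_mat])
  then have "det L * det P = det (four_block_mat (x \<cdot>\<^sub>m 1\<^sub>m n) B (0\<^sub>m m n) (x \<cdot>\<^sub>m 1\<^sub>m m - C * B))"
    using det_mult[OF carr(3,1)] by simp
  also have "\<dots> = x ^ n * chr x (C * B)"
    using B C by (subst det_four_block_mat_lower_left_zero[of _ n _ m]) (auto simp: chr_def)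
  also have "det L = x ^ m"
    unfolding L_def using C by (subst det_four_block_mat_upper_right_zero[of _ n _ m]) auto
  finally show ?thesis using 1 by simp
qed

lemma smult_mat_one_mult:
  fixes A :: "'a::comm_ring_1 mat"
  assumes "A \<in> carrier_mat n m"
  shows "(x \<cdot>\<^sub>m 1\<^sub>m n) * A = x \<cdot>\<^sub>m A" "A * (x \<cdot>\<^sub>m 1\<^sub>m m) = x \<cdot>\<^sub>m A"
  using mult_smult_assoc_mat[of "1\<^sub>m n" n n A m x] mult_smult_distrib[of A n m "1\<^sub>m m" m x] assms
  by auto

lemma mult_shift_mat:
  fixes A B :: "'a::comm_ring_1 mat"
  assumes A: "A \<in> carrier_mat n n" and B: "B \<in> carrier_mat n n"
  shows "(x \<cdot>\<^sub>m 1\<^sub>m n - A) * (y \<cdot>\<^sub>m 1\<^sub>m n - B) = (x * y) \<cdot>\<^sub>m 1\<^sub>m n - x \<cdot>\<^sub>m B - y \<cdot>\<^sub>m A + A * B"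
proof -
  have "y \<cdot>\<^sub>m 1\<^sub>m n - B \<in> carrier_mat n n" using B by auto
  note this = this smult_mat_one_mult(1)[OF this]
  then have "(x \<cdot>\<^sub>m 1\<^sub>m n - A) * (y \<cdot>\<^sub>m 1\<^sub>m n - B)
      = x \<cdot>\<^sub>m (y \<cdot>\<^sub>m 1\<^sub>m n - B) - (A * (y \<cdot>\<^sub>m 1\<^sub>m n) - A * B)"
    using A B by (subst minus_mult_distrib_mat[of _ n n _ _ n])
      (auto simp: mult_minus_distrib_mat[of A n n _ n] smult_mat_one_mult[of _ n n])
  also have "A * (y \<cdot>\<^sub>m 1\<^sub>m n) = y \<cdot>\<^sub>m A"
    using A by (simp add: smult_mat_one_mult)
  finally show ?thesis
    using A B by (auto simp: algebra_simps intro!: eq_matI)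
qed

text \<open>Put N = \<open>B\<^sup>T * B\<close>. Since M N = 0, the product of yI - M and yI - N is
  yK with K = yI - M - N. Clearing the lower left block of P leads to the same K, up to the factor
  x, so the contributions of M and B separate.\<close>

lemma chr_block:
  fixes x a :: "'a::idom"
  assumes M: "M \<in> carrier_mat n n" and B: "B \<in> carrier_mat m n"
    and MB: "M * B\<^sup>T = 0\<^sub>m n m"
    and nz: "chr x (B\<^sup>T * B) \<noteq> 0"
    and y: "y = x - a\<^sup>2"
  shows "y ^ n * chr x (four_block_mat (M + a\<^sup>2 \<cdot>\<^sub>m 1\<^sub>m n) (- (a \<cdot>\<^sub>m B\<^sup>T)) (- (a \<cdot>\<^sub>m B)) (B * B\<^sup>T))
     = x ^ m * (chr y M * chr y (B\<^sup>T * B))"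
proof -
  define N where "N = B\<^sup>T * B"
  define K where "K = y \<cdot>\<^sub>m 1\<^sub>m n - M - N"
  define P where "P = four_block_mat (y \<cdot>\<^sub>m 1\<^sub>m n - M) (a \<cdot>\<^sub>m B\<^sup>T) (a \<cdot>\<^sub>m B) (x \<cdot>\<^sub>m 1\<^sub>m m - B * B\<^sup>T)"
  \<comment> \<open>As (xI - \<open>B * B\<^sup>T\<close>) B = B (xI - N), the factor xI - N clears
    the lower left block without any inverse. The price is det Q = chr x N, which \<open>nz\<close>
    allows to cancel.\<close>
  define Q where "Q = four_block_mat (x \<cdot>\<^sub>m 1\<^sub>m n - N) (0\<^sub>m n m) (- (a \<cdot>\<^sub>m B)) (1\<^sub>m m)"
  have Bt: "B\<^sup>T \<in> carrier_mat n m" and N: "N \<in> carrier_mat n n"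
    using B by (auto simp: N_def)
  have MN: "M * N = 0\<^sub>m n n"
    using MB M B Bt by (simp add: N_def assoc_mult_mat[symmetric, of M n n "B\<^sup>T" m B n])
  have carr: "P \<in> carrier_mat (n + m) (n + m)" "Q \<in> carrier_mat (n + m) (n + m)"
    using B M N by (auto simp: P_def Q_def)
  have P: "chr x (four_block_mat (M + a\<^sup>2 \<cdot>\<^sub>m 1\<^sub>m n) (- (a \<cdot>\<^sub>m B\<^sup>T)) (- (a \<cdot>\<^sub>m B)) (B * B\<^sup>T)) = det P"
    unfolding chr_def P_def using M B
    by (intro arg_cong[where f=det] eq_matI) (auto simp: y)
  have aBt: "(a \<cdot>\<^sub>m B\<^sup>T) * (- (a \<cdot>\<^sub>m B)) = - (a\<^sup>2 \<cdot>\<^sub>m N)"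
    using B Bt by (auto simp: N_def power2_eq_square intro!: eq_matI)
  have BN: "(a \<cdot>\<^sub>m B) * N = a \<cdot>\<^sub>m (B * B\<^sup>T * B)"
    using B Bt by (simp add: N_def assoc_mult_mat[of B m n "B\<^sup>T" m B n] mult_smult_assoc_mat[of B m n "B\<^sup>T * B" n])
  have BBB: "(B * B\<^sup>T) * (a \<cdot>\<^sub>m B) = a \<cdot>\<^sub>m (B * B\<^sup>T * B)"
    using B Bt by (simp add: mult_smult_distrib[of "B * B\<^sup>T" m m B n])
  \<comment> \<open>With M N = 0 and y + a^2 = x the terms in N add up to -x N, so x factors
    out.\<close>
  have TL: "(y \<cdot>\<^sub>m 1\<^sub>m n - M) * (x \<cdot>\<^sub>m 1\<^sub>m n - N) + (a \<cdot>\<^sub>m B\<^sup>T) * (- (a \<cdot>\<^sub>m B)) = x \<cdot>\<^sub>m K"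
    unfolding aBt using M N by (auto simp: mult_shift_mat MN K_def y algebra_simps intro!: eq_matI)
  have BL: "(a \<cdot>\<^sub>m B) * (x \<cdot>\<^sub>m 1\<^sub>m n - N) + (x \<cdot>\<^sub>m 1\<^sub>m m - B * B\<^sup>T) * (- (a \<cdot>\<^sub>m B)) = 0\<^sub>m m n"
  proof -
    have "(a \<cdot>\<^sub>m B) * (x \<cdot>\<^sub>m 1\<^sub>m n - N) = x \<cdot>\<^sub>m (a \<cdot>\<^sub>m B) - a \<cdot>\<^sub>m (B * B\<^sup>T * B)"
      using B N by (simp add: mult_minus_distrib_mat[of _ m n _ n] BN smult_mat_one_mult[of _ m n])
    moreover have "(x \<cdot>\<^sub>m 1\<^sub>m m - B * B\<^sup>T) * (- (a \<cdot>\<^sub>m B)) = - (x \<cdot>\<^sub>m (a \<cdot>\<^sub>m B) - a \<cdot>\<^sub>m (B * B\<^sup>T * B))"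
      using B by (simp add: minus_mult_distrib_mat[of _ m m _ _ n] BBB smult_mat_one_mult[of _ m n])
    ultimately show ?thesis using B by auto
  qed
  have "P * Q = four_block_mat (x \<cdot>\<^sub>m K) (a \<cdot>\<^sub>m B\<^sup>T) (0\<^sub>m m n) (x \<cdot>\<^sub>m 1\<^sub>m m - B * B\<^sup>T)"
  proof -
    have "P * Q = four_block_mat
      ((y \<cdot>\<^sub>m 1\<^sub>m n - M) * (x \<cdot>\<^sub>m 1\<^sub>m n - N) + (a \<cdot>\<^sub>m B\<^sup>T) * (- (a \<cdot>\<^sub>m B)))
      ((y \<cdot>\<^sub>m 1\<^sub>m n - M) * 0\<^sub>m n m + (a \<cdot>\<^sub>m B\<^sup>T) * 1\<^sub>m m)
      ((a \<cdot>\<^sub>m B) * (x \<cdot>\<^sub>m 1\<^sub>m n - N) + (x \<cdot>\<^sub>m 1\<^sub>m m - B * B\<^sup>T) * (- (a \<cdot>\<^sub>m B)))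
      ((a \<cdot>\<^sub>m B) * 0\<^sub>m n m + (x \<cdot>\<^sub>m 1\<^sub>m m - B * B\<^sup>T) * 1\<^sub>m m)"
      unfolding P_def Q_def using B Bt M N by (intro mult_four_block_mat[of _ n n _ m _ m]) auto
    then show ?thesis
      unfolding TL BL using B M by (auto intro!: arg_cong4[where f=four_block_mat])
  qed
  then have "det P * det Q = det (four_block_mat (x \<cdot>\<^sub>m K) (a \<cdot>\<^sub>m B\<^sup>T) (0\<^sub>m m n) (x \<cdot>\<^sub>m 1\<^sub>m m - B * B\<^sup>T))"
    using det_mult[OF carr] by simp
  also have "\<dots> = x ^ n * det K * chr x (B * B\<^sup>T)"
    using M N B by (subst det_four_block_mat_lower_left_zero[of _ n _ m]) (auto simp: chr_def K_def)
  \<comment> \<open>Passing from \<open>B * B\<^sup>T\<close> to N trades x^n for x^m and makes det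
    Q a common factor of both sides.\<close>
  also have "\<dots> = det K * (x ^ m * chr x N)"
    using chr_mult_commute[OF B Bt, of x] by (simp add: N_def ac_simps)
  also have "det Q = chr x N"
    unfolding Q_def using B N by (subst det_four_block_mat_upper_right_zero[of _ n _ m]) (auto simp: chr_def)
  finally have dP: "det P = x ^ m * det K"
    using nz by (simp add: N_def)
  have "chr y M * chr y N = det ((y \<cdot>\<^sub>m 1\<^sub>m n - M) * (y \<cdot>\<^sub>m 1\<^sub>m n - N))"
    using M N by (subst det_mult[of _ n]) (auto simp: chr_def)
  also have "(y \<cdot>\<^sub>m 1\<^sub>m n - M) * (y \<cdot>\<^sub>m 1\<^sub>m n - N) = y \<cdot>\<^sub>m K"
    using M N by (auto simp: mult_shift_mat MN K_def algebra_simps intro!: eq_matI)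
  also have "det (y \<cdot>\<^sub>m K) = y ^ n * det K"
    using M N by (simp add: K_def)
  finally show ?thesis
    using dP P by (simp add: N_def)
qed


section \<open>Substitution in characteristic polynomials, and spectra up to the multiplicity of
  0\<close>

interpretation const_poly_hom: comm_ring_hom "\<lambda>a::'a::idom. [:a:]"
  by unfold_locales (simp_all add: one_pCons)

lemma const_mat_hom:
  fixes A B :: "'a::idom mat"
  shows "A \<in> carrier_mat n m \<Longrightarrow> B \<in> carrier_mat m k \<Longrightarrow>
    map_mat (\<lambda>a. [:a:]) (A * B) = map_mat (\<lambda>a. [:a:]) A * map_mat (\<lambda>a. [:a:]) B"
  by (rule const_poly_hom.mat_hom_mult)

text \<open>Substitution of q is a ring homomorphism and so commutes with det. Over a polynomial
  ring, q may be the indeterminate t as well as t - a^2, the two arguments that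
  \<open>chr_block\<close> relates.\<close>

lemma chr_const_mat:
  fixes A :: "'a::idom mat"
  assumes A: "A \<in> carrier_mat n n"
  shows "chr q (map_mat (\<lambda>a. [:a:]) A) = pcompose (char_poly A) q"
proof -
  have "pcompose (char_poly A) q = det (map_mat (\<lambda>p. pcompose p q) (char_poly_matrix A))"
    unfolding char_poly_def by (rule comm_ring_hom.hom_det[OF pcompose_hom.comm_ring_hom_axioms, symmetric])
  also have "map_mat (\<lambda>p. pcompose p q) (char_poly_matrix A)
      = q \<cdot>\<^sub>m 1\<^sub>m (dim_row A) - map_mat (\<lambda>a. [:a:]) A"
    using A unfolding char_poly_matrix_def
    by (intro eq_matI) (auto simp: pcompose_add pcompose_mult pcompose_pCons pcompose_1)
  finally show ?thesis by (simp add: chr_def)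
qed

lemma char_poly_eq_chr:
  "A \<in> carrier_mat n n \<Longrightarrow> char_poly A = chr [:0, 1:] (map_mat (\<lambda>a. [:a:]) A)"
  by (simp only: chr_const_mat pcompose_idR)

lemma char_poly_nonzero:
  fixes A :: "'a::idom mat"
  shows "A \<in> carrier_mat n n \<Longrightarrow> char_poly A \<noteq> 0"
  using degree_monic_char_poly[of A n] by auto

text \<open>\<open>V\<close> lists the eigenvalues of \<open>A\<close> up to the multiplicity of 0; the powers on both sides avoid
  truncated subtraction.\<close>

definition spectral :: "'a::idom mat \<Rightarrow> 'a multiset \<Rightarrow> bool" where
  "spectral A V \<longleftrightarrow>
     [:0, 1:] ^ size V * char_poly A = [:0, 1:] ^ dim_row A * (\<Prod>v\<in>#V. [:- v, 1:])"

lemma spectral_mult_commute: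
  fixes B C :: "'a::idom mat"
  assumes B: "B \<in> carrier_mat n m" and C: "C \<in> carrier_mat m n" and S: "spectral (B * C) V"
  shows "spectral (C * B) V"
proof -
  let ?X = "[:0, 1:] :: 'a poly"
  have "?X ^ m * char_poly (B * C) = ?X ^ n * char_poly (C * B)"
    using B C chr_mult_commute[of "map_mat (\<lambda>a. [:a:]) B" n m "map_mat (\<lambda>a. [:a:]) C" ?X]
    by (simp add: char_poly_eq_chr[of _ n] char_poly_eq_chr[of _ m] const_mat_hom[of _ n m _ n]
        const_mat_hom[of _ m n _ m])
  then have "?X ^ n * (?X ^ size V * char_poly (C * B)) = ?X ^ m * (?X ^ size V * char_poly (B * C))"
    by (simp add: ac_simps)
  also have "\<dots> = ?X ^ n * (?X ^ m * (\<Prod>v\<in>#V. [:- v, 1:]))"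
    using S B by (simp add: spectral_def ac_simps)
  finally show ?thesis
    using C by (simp add: spectral_def)
qed

lemma spectral_pcompose:
  fixes A :: "'a::idom mat"
  assumes "A \<in> carrier_mat n n" "spectral A V"
  shows "q ^ size V * pcompose (char_poly A) q = q ^ n * (\<Prod>v\<in>#V. q - [:v:])"
proof -
  have pc: "pcompose [:- v, 1:] q = q - [:v:]" for v
    by (simp add: pcompose_pCons)
  have "pcompose ([:0, 1:] ^ size V * char_poly A) q
      = pcompose ([:0, 1:] ^ n * (\<Prod>v\<in>#V. [:- v, 1:])) q"
    using assms by (simp add: spectral_def)
  moreover have "pcompose [:0, 1:] q = q"
    by (simp add: pcompose_pCons)
  ultimately show ?thesis
    by (simp only: pcompose_mult pcompose_hom.hom_power pcompose_hom.hom_prod_mset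
        image_mset.compositionality comp_def pc)
qed

text \<open>The characteristic polynomial of kA at kX is k^n times that of A at X. The identity is
  therefore checked after substituting kX for X, which loses nothing because kX is not
  constant.\<close>

lemma spectral_smult:
  fixes A :: "'a::idom mat"
  assumes A: "A \<in> carrier_mat n n" and S: "spectral A V" and k: "k \<noteq> 0"
  shows "spectral (k \<cdot>\<^sub>m A) (image_mset ((*) k) V)"
proof -
  let ?X = "[:0, 1:] :: 'a poly" and ?K = "[:0, k:]"
  let ?D = "?X ^ size V * char_poly (k \<cdot>\<^sub>m A) - ?X ^ n * (\<Prod>v\<in>#V. [:- (k * v), 1:])"
  have K: "?K = smult k ?X" by simp
  have kA: "k \<cdot>\<^sub>m A \<in> carrier_mat n n" using A by simp
  have "pcompose (char_poly (k \<cdot>\<^sub>m A)) ?K = chr ?K (map_mat (\<lambda>a. [:a:]) (k \<cdot>\<^sub>m A))"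
    by (simp only: chr_const_mat[OF kA])
  also have "\<dots> = det ([:k:] \<cdot>\<^sub>m (?X \<cdot>\<^sub>m 1\<^sub>m n - map_mat (\<lambda>a. [:a:]) A))"
    unfolding chr_def using A by (intro arg_cong[where f=det] eq_matI) auto
  also have "\<dots> = [:k:] ^ n * char_poly A"
    using A by (simp add: char_poly_eq_chr chr_def)
  finally have 1: "pcompose (char_poly (k \<cdot>\<^sub>m A)) ?K = [:k:] ^ n * char_poly A" .
  have pc: "pcompose [:- (k * v), 1:] ?K = [:k:] * [:- v, 1:]" for v
    by (simp add: pcompose_pCons)
  have pX: "pcompose ?X ?K = [:k:] * ?X"
    by (simp add: pcompose_pCons)
  have "pcompose ?D ?K
      = ([:k:] * ?X) ^ size V * ([:k:] ^ n * char_poly A)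
        - ([:k:] * ?X) ^ n * (\<Prod>v\<in>#V. [:k:] * [:- v, 1:])"
    by (simp only: pcompose_diff pcompose_mult pcompose_hom.hom_power pcompose_hom.hom_prod_mset image_mset.compositionality comp_def
        1 pc pX)
  also have "\<dots> = [:k:] ^ (size V + n) * (?X ^ size V * char_poly A - ?X ^ n * (\<Prod>v\<in>#V. [:- v, 1:]))"
    by (simp only: prod_mset.distrib prod_mset_constant power_mult_distrib power_add algebra_simps)
  also have "\<dots> = 0"
    using S A by (simp only: spectral_def) simp
  finally have "?D = 0"
    using k by (subst (asm) pcompose_eq_0_iff) auto
  then show ?thesis
    using A by (simp add: spectral_def image_mset.compositionality comp_def)
qed

text \<open>This is \<open>chr_block\<close> with x = t and y = u = t - a^2. The identities for M
  and \<open>B\<^sup>T * B\<close> each bring a factor u^n, and only one cancels. The other, divided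
  by u to the power size V + size W, gives the multiplicity of a^2.\<close>

lemma spectral_block:
  fixes M B :: "'a::idom mat"
  assumes M: "M \<in> carrier_mat n n" and B: "B \<in> carrier_mat m n"
    and MB: "M * B\<^sup>T = 0\<^sub>m n m"
    and V: "spectral M V" and W: "spectral (B * B\<^sup>T) W" and size: "size V + size W \<le> n"
  shows "spectral (four_block_mat (M + a\<^sup>2 \<cdot>\<^sub>m 1\<^sub>m n) (- (a \<cdot>\<^sub>m B\<^sup>T)) (- (a \<cdot>\<^sub>m B)) (B * B\<^sup>T))
    (image_mset ((+) (a\<^sup>2)) (V + W) + replicate_mset (n - size V - size W) (a\<^sup>2))"
    (is "spectral ?D ?U")
proof -
  let ?c = "map_mat (\<lambda>a::'a. [:a:])"
  define t where "t = ([:0, 1:] :: 'a poly)"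
  define u where "u = ([:- (a\<^sup>2), 1:] :: 'a poly)"
  have tu: "u = t - [:a:]\<^sup>2" and u0: "u \<noteq> 0"
    by (simp_all add: t_def u_def power2_eq_square)
  have Bt: "B\<^sup>T \<in> carrier_mat n m" and N: "B\<^sup>T * B \<in> carrier_mat n n"
    and D: "?D \<in> carrier_mat (n + m) (n + m)"
    using B M by auto
  have cN: "?c (B\<^sup>T * B) = (?c B)\<^sup>T * ?c B" "?c (B * B\<^sup>T) = ?c B * (?c B)\<^sup>T" "?c (M * B\<^sup>T) = ?c M * (?c B)\<^sup>T"
    using B Bt M by (simp_all add: const_mat_hom[of _ n m _ n] const_mat_hom[of _ m n _ m] const_mat_hom[of _ n n _ m] map_mat_transpose)
  have cD: "?c ?D = four_block_mat (?c M + [:a:]\<^sup>2 \<cdot>\<^sub>m 1\<^sub>m n) (- ([:a:] \<cdot>\<^sub>m (?c B)\<^sup>T)) (- ([:a:] \<cdot>\<^sub>m ?c B)) (?c B * (?c B)\<^sup>T)"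
    unfolding cN(2)[symmetric] using M B
    by (intro eq_matI) (auto simp: power2_eq_square)
  have nz: "chr t ((?c B)\<^sup>T * ?c B) \<noteq> 0"
    using char_poly_nonzero[OF N] unfolding char_poly_eq_chr[OF N] cN t_def .
  have cMB: "?c M * (?c B)\<^sup>T = 0\<^sub>m n m"
    unfolding cN[symmetric] MB by auto
  have "u ^ n * char_poly ?D = t ^ m * (pcompose (char_poly M) u * pcompose (char_poly (B\<^sup>T * B)) u)"
    unfolding char_poly_eq_chr[OF D] cD chr_const_mat[OF M, symmetric] chr_const_mat[OF N, symmetric] cN t_def[symmetric]
    by (rule chr_block[OF _ _ cMB nz tu]) (use M B in auto)
  then have "(u ^ size V * u ^ size W) * (u ^ n * char_poly ?D)
      = t ^ m * ((u ^ size V * pcompose (char_poly M) u) * (u ^ size W * pcompose (char_poly (B\<^sup>T * B)) u))"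
    by (simp add: ac_simps)
  also have "u ^ size V * pcompose (char_poly M) u = u ^ n * (\<Prod>v\<in>#V. u - [:v:])"
    by (rule spectral_pcompose[OF M V])
  also have "u ^ size W * pcompose (char_poly (B\<^sup>T * B)) u = u ^ n * (\<Prod>v\<in>#W. u - [:v:])"
    by (rule spectral_pcompose[OF N spectral_mult_commute[OF B Bt W]])
  also have "t ^ m * (u ^ n * (\<Prod>v\<in>#V. u - [:v:]) * (u ^ n * (\<Prod>v\<in>#W. u - [:v:])))
      = (u ^ size V * u ^ size W) * (u ^ n * (t ^ m * ((\<Prod>v\<in>#V + W. u - [:v:]) * u ^ (n - size V - size W))))"
  proof -
    have "u ^ n = u ^ size V * u ^ size W * u ^ (n - size V - size W)"
      using size by (simp flip: power_add)
    then show ?thesis by (simp add: ac_simps)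
  qed
  finally have "char_poly ?D = t ^ m * ((\<Prod>v\<in>#V + W. u - [:v:]) * u ^ (n - size V - size W))"
    using u0 by simp
  moreover have "(\<Prod>v\<in>#?U. [:- v, 1:]) = (\<Prod>v\<in>#V + W. u - [:v:]) * u ^ (n - size V - size W)"
    by (simp add: u_def image_mset.compositionality comp_def)
  moreover have "size ?U = n" using size by simp
  moreover have "dim_row ?D = n + m" using M B by simp
  ultimately show ?thesis
    unfolding spectral_def t_def by (simp only: power_add mult.assoc)
qed

lemma map_poly_prod_mset_linear:
  assumes "comm_ring_hom h"
  shows "map_poly h (\<Prod>v\<in>#V. [:- v, 1:]) = (\<Prod>v\<in>#image_mset h V. [:- v, 1:])"
proof -
  interpret comm_ring_hom h by fact
  interpret mp: map_poly_comm_ring_hom h ..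
  show ?thesis
    unfolding mp.hom_prod_mset image_mset.compositionality comp_def by (simp add: hom_distribs)
qed

lemma spectral_map_mat:
  fixes A :: "'a::idom mat" and h :: "'a \<Rightarrow> 'b::idom"
  assumes "comm_ring_hom h" and A: "A \<in> carrier_mat n n" and S: "spectral A V"
  shows "spectral (map_mat h A) (image_mset h V)"
proof -
  interpret comm_ring_hom h by fact
  interpret mp: map_poly_comm_ring_hom h ..
  have "map_poly h ([:0, 1:] ^ size V * char_poly A)
      = map_poly h ([:0, 1:] ^ dim_row A * (\<Prod>v\<in>#V. [:- v, 1:]))"
    using S by (simp add: spectral_def)
  moreover have "map_poly h [:0, 1:] = [:0, 1:]"
    by (simp add: hom_distribs)
  ultimately show ?thesis
    using A by (simp only: spectral_def mp.hom_mult mp.hom_power map_poly_prod_mset_linear[OF assms(1)]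
        char_poly_hom[OF A] size_image_mset index_map_mat)
qed

lemma nonzero_part_add [simp]: "nonzero_part (M + N) = nonzero_part M + nonzero_part N"
  by (simp add: nonzero_part_def)

text \<open>The powers of the indeterminate on both sides of \<open>spectral\<close> have only the
  root 0, which \<open>nonzero_part\<close> discards.\<close>

lemma nonzero_part_proots:
  fixes A :: "'a::idom mat"
  assumes A: "A \<in> carrier_mat n n" and S: "spectral A V"
  shows "nonzero_part (proots (char_poly A)) = nonzero_part V"
proof -
  have X: "nonzero_part (proots ([:0, 1::'a:] ^ k)) = {#}" for k
    using proots_linear_factor[of "0::'a"] by (simp add: proots_power nonzero_part_def)
  have "proots (\<Prod>v\<in>#V. [:- v, 1:]) = V"
  proof -
    have "proots (\<Prod>v\<in>#V. [:- v, 1:]) = (\<Sum>v\<in>#V. proots [:- v, 1:])"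
    proof -
      have "0 \<notin># image_mset (\<lambda>v. [:- v, 1:]) V" by auto
      from proots_prod_mset[OF this] show ?thesis
        by (simp only: image_mset.compositionality comp_def image_mset.id)
    qed
    also have "\<dots> = (\<Sum>v\<in>#V. {#v#})"
      by (simp only: proots_linear_factor minus_minus)
    finally show ?thesis by simp
  qed
  moreover have "(\<Prod>v\<in>#V. [:- v, 1:]) \<noteq> 0"
    by (auto simp: prod_mset_zero_iff)
  ultimately show ?thesis
    using arg_cong[OF S[unfolded spectral_def], of "\<lambda>p. nonzero_part (proots p)"]
    by (simp add: proots_mult char_poly_nonzero[OF A] X[simplified])
qed

section \<open>Identities for z(S,T)\<close>

lemma lookup_sum_mset_single:
  "Poly_Mapping.lookup (\<Sum>j\<in>#T. Poly_Mapping.single (f j) (1::'b::comm_semiring_1)) m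
    = of_nat (count (image_mset f T) m)"
  by (induction T) (auto simp: lookup_add lookup_single when_def)

lemma Fract_sum_mset:
  "(\<Sum>j\<in>#T. Fract (f j) 1) = Fract (\<Sum>j\<in>#T. f j) (1::'a::idom)"
  by (induction T) (simp_all add: Zero_fract_def)

interpretation uparrow: field_hom uparrow
proof
  show "uparrow 0 = 0"
    unfolding Zero_fract_def by (subst uparrow_Fract) simp_all
  show "uparrow 1 = 1"
    unfolding One_fract_def by (subst uparrow_Fract) simp_all
qed (simp_all add: uparrow_add uparrow_mult)

lemma field_hom_uparrow_funpow: "field_hom (uparrow ^^ n)"
proof (induction n)
  case 0
  show ?case by unfold_locales simp_all
next
  case (Suc n)
  then interpret field_hom "uparrow ^^ n" .
  show ?case
    by unfold_locales (simp_all add: hom_add hom_mult uparrow_add uparrow_mult)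
qed

lemma xv_nonzero [simp]: "xv a j \<noteq> 0"
proof
  assume "xv a j = 0"
  then have "Poly_Mapping.single (Poly_Mapping.single (XVar a j) 1) 1 = (0::cpoly)"
    unfolding xv_def Zero_fract_def
    by (simp only: eq_fract one_neq_zero not_False_eq_True mult_1_right)
  then show False
    by (metis lookup_single_eq lookup_zero one_neq_zero)
qed

lemma xm_nonzero [simp]: "xm S \<noteq> 0"
  by (simp add: xm_def)

lemma sorted_list_of_multiset_add_min:
  assumes "\<And>x. x \<in># S \<Longrightarrow> p \<le> x"
  shows "sorted_list_of_multiset (add_mset p S) = p # sorted_list_of_multiset S"
  using assms by (simp add: insort_is_Cons)

text \<open>A least element takes the first place of the sorted list and moves every other entry one
  place on, which is what \<open>uparrow\<close> does to first indices.\<close>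

lemma xm_add_min:
  assumes "\<And>x. x \<in># S \<Longrightarrow> p \<le> x"
  shows "xm (add_mset p S) = xv 1 p * uparrow (xm S)"
proof -
  have "sorted_list_of_multiset (add_mset p S) = p # sorted_list_of_multiset S"
    by (rule sorted_list_of_multiset_add_min) (fact assms)
  then show ?thesis
    unfolding xm_def uparrow.hom_prod size_add_mset prod.lessThan_Suc_shift
    by (simp add: uparrow_xv del: sorted_list_of_multiset_insert)
qed

lemma Xm_add_min:
  assumes "\<And>x. x \<in># S \<Longrightarrow> p \<le> x"
  shows "Xm (add_mset p S) = (xv 1 p)\<^sup>2 * uparrow (Xm S)"
proof -
  have "xm (add_mset p S) = xv 1 p * uparrow (xm S)"
    by (rule xm_add_min) (fact assms)
  then show ?thesis
    unfolding Xm_def by (simp only: power_mult_distrib uparrow.hom_power)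
qed

lemma Xm_nonzero [simp]: "Xm S \<noteq> 0"
  by (simp add: Xm_def)

lemma zpoly_mult_uparrow_Xm: "uparrow (Xm S) * zpoly S T = (\<Sum>j\<in>#T. Xm (add_mset j S))"
proof -
  have "u * (1 / u * s) = s" if "u \<noteq> 0" for u s :: ratfun
    using that by simp
  from this[of "uparrow (Xm S)" "\<Sum>j\<in>#T. Xm (add_mset j S)"] show ?thesis
    unfolding zpoly_def by (simp only: uparrow.hom_0_iff Xm_nonzero not_False_eq_True)
qed

lemma zpoly_eqI:
  "uparrow (Xm S) * w = (\<Sum>j\<in>#T. Xm (add_mset j S)) \<Longrightarrow> zpoly S T = w"
  using zpoly_mult_uparrow_Xm[of S T] by (metis Xm_nonzero mult_left_cancel uparrow.hom_0_iff)

lemma zpoly_add_min_right: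
  assumes "\<And>x. x \<in># S \<Longrightarrow> p \<le> x"
  shows "zpoly S (add_mset p T) = (xv 1 p)\<^sup>2 + zpoly S T"
  by (rule zpoly_eqI) (simp add: distrib_left zpoly_mult_uparrow_Xm Xm_add_min[OF assms])

text \<open>In every numerator p contributes the square of \<open>xv 1 p\<close>; in the
  denominator, which carries one more \<open>uparrow\<close>, it contributes the square of
  \<open>xv 2 p\<close>. The quotient is the factor in front of the shifted value.\<close>

lemma zpoly_add_min_both:
  assumes S: "\<And>x. x \<in># S \<Longrightarrow> p \<le> x" and T: "\<And>x. x \<in># T \<Longrightarrow> p \<le> x"
  shows "zpoly (add_mset p S) (add_mset p T) = (xv 1 p)\<^sup>2 + (xv 1 p / xv 2 p)\<^sup>2 * uparrow (zpoly S T)"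
proof -
  have "zpoly (add_mset p S) (add_mset p T) = (xv 1 p)\<^sup>2 + zpoly (add_mset p S) T"
    by (rule zpoly_add_min_right) (use S in auto)
  also have "zpoly (add_mset p S) T = (xv 1 p / xv 2 p)\<^sup>2 * uparrow (zpoly S T)"
  proof (rule zpoly_eqI)
    have "uparrow (Xm (add_mset p S)) = (xv 2 p)\<^sup>2 * uparrow (uparrow (Xm S))"
    proof -
      have "Xm (add_mset p S) = (xv 1 p)\<^sup>2 * uparrow (Xm S)"
        by (rule Xm_add_min) (fact S)
      moreover have "uparrow (xv 1 p) = xv 2 p"
        by (simp add: uparrow_xv numeral_2_eq_2)
      ultimately show ?thesis
        by (simp only: uparrow_mult uparrow.hom_power)
    qed
    then have "uparrow (Xm (add_mset p S)) * ((xv 1 p / xv 2 p)\<^sup>2 * uparrow (zpoly S T))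
        = (xv 1 p)\<^sup>2 * uparrow (uparrow (Xm S) * zpoly S T)"
      by (simp add: power_divide uparrow_mult)
    also have "\<dots> = (\<Sum>j\<in>#T. (xv 1 p)\<^sup>2 * uparrow (Xm (add_mset j S)))"
      unfolding zpoly_mult_uparrow_Xm
      by (simp add: sum_mset_distrib_left uparrow.hom_sum_mset image_mset.compositionality comp_def)
    also have "\<dots> = (\<Sum>j\<in>#T. Xm (add_mset j (add_mset p S)))"
    proof (intro arg_cong[where f = sum_mset] image_mset_cong)
      fix j assume "j \<in># T"
      then have "Xm (add_mset p (add_mset j S)) = (xv 1 p)\<^sup>2 * uparrow (Xm (add_mset j S))"
        by (intro Xm_add_min) (use S T in auto)
      then show "(xv 1 p)\<^sup>2 * uparrow (Xm (add_mset j S)) = Xm (add_mset j (add_mset p S))"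
        by (simp add: add_mset_commute)
    qed
    finally show "uparrow (Xm (add_mset p S)) * ((xv 1 p / xv 2 p)\<^sup>2 * uparrow (zpoly S T))
        = (\<Sum>j\<in>#T. Xm (add_mset j (add_mset p S)))" .
  qed
  finally show ?thesis .
qed

section \<open>Exponent vectors of the monomials in z(S,T)\<close>

definition expo :: "int multiset \<Rightarrow> mono" where
  "expo S = (\<Sum>k<size S. Poly_Mapping.single (XVar (k + 1) (sorted_list_of_multiset S ! k)) 1)"

lemma xm_eq_Fract: "xm S = Fract (Poly_Mapping.single (expo S) 1) 1"
proof -
  have "(\<Prod>k\<in>K. Fract (Poly_Mapping.single (m k) 1) 1) = Fract (Poly_Mapping.single (\<Sum>k\<in>K. m k) (1::complex)) 1"
    for K :: "nat set" and m :: "nat \<Rightarrow> mono"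
    by (induction K rule: infinite_finite_induct) (simp_all add: One_fract_def mult_single)
  then show ?thesis
    unfolding xm_def xv_def expo_def .
qed

lemma Xm_eq_Fract: "Xm S = Fract (Poly_Mapping.single (expo S + expo S) 1) 1"
  unfolding Xm_def xm_eq_Fract power2_eq_square mult_fract mult_single mult_1 ..

lemma lookup_expo_row_0: "Poly_Mapping.lookup (expo S) (XVar 0 l) = 0"
  unfolding expo_def lookup_sum by (intro sum.neutral ballI) (simp add: lookup_single when_def)

lemma lookup_expo_row_1:
  "Poly_Mapping.lookup (expo (add_mset j S)) (XVar 1 l)
    = (if sorted_list_of_multiset (add_mset j S) ! 0 = l then 1 else 0)"
proof -
  have "Poly_Mapping.lookup (expo (add_mset j S)) (XVar 1 l)
      = (\<Sum>k<Suc (size S). if k = 0 \<and> sorted_list_of_multiset (add_mset j S) ! k = l then 1 else 0)"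
    unfolding expo_def lookup_sum by (intro sum.cong) (auto simp: lookup_single when_def)
  also have "\<dots> = (\<Sum>k\<in>{0}. if k = 0 \<and> sorted_list_of_multiset (add_mset j S) ! k = l then 1 else 0)"
    by (rule sum.mono_neutral_right) auto
  finally show ?thesis by simp
qed

text \<open>Once the denominators are cleared, both sides are sums of monomials with coefficient 1.
  The coefficient of an exponent vector is then its multiplicity, which can be read off because the
  complex numbers have characteristic 0.\<close>

lemma zpoly_eq_imp_expo_eq:
  assumes "zpoly S T = zpoly S' T'"
  shows "image_mset (\<lambda>j. push shift_var (expo S' + expo S') + (expo (add_mset j S) + expo (add_mset j S))) T
       = image_mset (\<lambda>j. push shift_var (expo S + expo S) + (expo (add_mset j S') + expo (add_mset j S'))) T'"
    (is "?L = ?R")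
proof -
  let ?s = "\<lambda>m. Poly_Mapping.single (m :: mono) (1::complex)"
  let ?u = "\<lambda>S. push shift_var (expo S + expo S)"
  have z: "uparrow (Xm S) * zpoly S T = Fract (\<Sum>j\<in>#T. ?s (expo (add_mset j S) + expo (add_mset j S))) 1" for S T
    unfolding zpoly_mult_uparrow_Xm unfolding Xm_eq_Fract by (rule Fract_sum_mset)
  have u: "uparrow (Xm S) = Fract (?s (?u S)) 1" for S
    unfolding Xm_eq_Fract by (subst uparrow_Fract) (simp_all, simp add: up_poly_def)
  have "uparrow (Xm S') * (uparrow (Xm S) * zpoly S T) = uparrow (Xm S) * (uparrow (Xm S') * zpoly S' T')"
    unfolding assms by (rule mult.left_commute)
  then have "?s (?u S') * (\<Sum>j\<in>#T. ?s (expo (add_mset j S) + expo (add_mset j S)))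
      = ?s (?u S) * (\<Sum>j\<in>#T'. ?s (expo (add_mset j S') + expo (add_mset j S')))"
    unfolding z unfolding u mult_fract mult_1 by (simp only: eq_fract one_neq_zero not_False_eq_True mult_1_right)
  then have eq: "(\<Sum>j\<in>#T. ?s (?u S' + (expo (add_mset j S) + expo (add_mset j S))))
      = (\<Sum>j\<in>#T'. ?s (?u S + (expo (add_mset j S') + expo (add_mset j S'))))"
    unfolding sum_mset_distrib_left image_mset.compositionality comp_def mult_single mult_1 .
  show ?thesis
  proof (rule multiset_eqI)
    fix m
    have "(of_nat (count ?L m) :: complex) = of_nat (count ?R m)"
      using arg_cong[OF eq, of "\<lambda>p. Poly_Mapping.lookup p m"] unfolding lookup_sum_mset_single .
    then show "count ?L m = count ?R m" by simp
  qed
qed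

text \<open>The variable of first index 1 in the monomial of \<open>Xm (add_mset j S)\<close> is that of the least
  element of \<open>add_mset j S\<close>, and no such variable occurs in \<open>uparrow (Xm S)\<close>.\<close>

lemma zpoly_eq_imp_bounded_below:
  assumes eq: "zpoly S T = zpoly S' T'" and q: "\<And>x. x \<in># S' + T' \<Longrightarrow> q \<le> x"
    and j: "j \<in># T" and x: "x \<in># add_mset j S"
  shows "q \<le> x"
proof -
  let ?hd = "\<lambda>j S. sorted_list_of_multiset (add_mset j S) ! 0"
  obtain j' where j': "j' \<in># T'" and e:
    "push shift_var (expo S' + expo S') + (expo (add_mset j S) + expo (add_mset j S))
     = push shift_var (expo S + expo S) + (expo (add_mset j' S') + expo (add_mset j' S'))"
  proof -
    let ?f = "\<lambda>j. push shift_var (expo S' + expo S') + (expo (add_mset j S) + expo (add_mset j S))"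
    have "?f j \<in># image_mset ?f T"
      unfolding set_image_mset using j by (rule imageI)
    then have "?f j \<in># image_mset (\<lambda>j. push shift_var (expo S + expo S)
        + (expo (add_mset j S') + expo (add_mset j S'))) T'"
      unfolding zpoly_eq_imp_expo_eq[OF eq] .
    then show ?thesis
      unfolding set_image_mset by (elim imageE) (rule that)
  qed
  \<comment> \<open>\<open>XVar 1 l\<close> is the image of \<open>XVar 0 l\<close>, which never
    occurs since first indices start at 1.\<close>
  have "Poly_Mapping.lookup (push shift_var (expo R + expo R)) (XVar 1 l) = 0" for R l
    using lookup_push[OF inj_shift_var, of "expo R + expo R" "XVar 0 l"]
    by (simp add: lookup_add lookup_expo_row_0)
  then have hd: "?hd j S = ?hd j' S'"
    using arg_cong[OF e, of "\<lambda>m. Poly_Mapping.lookup m (XVar 1 (?hd j S))"]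
    unfolding lookup_add lookup_expo_row_1 by (auto split: if_splits)
  have "?hd j' S' \<in> set (sorted_list_of_multiset (add_mset j' S'))"
    by (rule nth_mem) simp
  then have "?hd j' S' \<in># add_mset j' S'"
    unfolding set_sorted_list_of_multiset .
  then have "q \<le> ?hd j' S'"
    using q j' by auto
  also have "?hd j' S' \<le> x"
  proof -
    have "x \<in> set (sorted_list_of_multiset (add_mset j S))"
      using x by (simp only: set_sorted_list_of_multiset)
    then obtain k where "k < length (sorted_list_of_multiset (add_mset j S))"
      "x = sorted_list_of_multiset (add_mset j S) ! k" by (metis in_set_conv_nth)
    moreover from this(1) have "?hd j S \<le> sorted_list_of_multiset (add_mset j S) ! k"
      by (intro sorted_nth_mono) (simp_all only: sorted_sorted_list_of_multiset le0)
    ultimately show ?thesis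
      unfolding hd by (simp only:)
  qed
  finally show ?thesis .
qed

lemma zpoly_empty [simp]: "zpoly S {#} = 0"
  by (simp add: zpoly_def)

text \<open>The monomials cannot cancel: compared with an empty T, the multiset of exponent vectors
  must be empty.\<close>

lemma zpoly_eq_0_iff: "zpoly S T = 0 \<longleftrightarrow> T = {#}"
proof
  assume "zpoly S T = 0"
  then have "zpoly S T = zpoly S {#}" by simp
  from zpoly_eq_imp_expo_eq[OF this] show "T = {#}" by simp
qed simp

section \<open>Weighted boundary matrices of families of sets\<close>

text \<open>The unweighted boundary coefficient. The sum has at most one term; as a sum it is 0
  without a case distinction when G is not obtained from F by removing an element.\<close>

definition incidence :: "int set \<Rightarrow> int set \<Rightarrow> int" where
  "incidence G F = (\<Sum>j | j \<in> F \<and> F - {j} = G. eps j F)"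

lemma incidence_remove: "j \<in> F \<Longrightarrow> incidence (F - {j}) F = eps j F"
proof -
  assume "j \<in> F"
  then have "{j'. j' \<in> F \<and> F - {j'} = F - {j}} = {j}" by blast
  then show ?thesis by (simp add: incidence_def)
qed

lemma incidence_eq_0:
  assumes "\<And>j. j \<in> F \<Longrightarrow> F - {j} \<noteq> G"
  shows "incidence G F = 0"
proof -
  have "{j. j \<in> F \<and> F - {j} = G} = {}" using assms by simp
  then show ?thesis unfolding incidence_def by (simp only: sum.empty)
qed

lemma incidence_insert_min:
  assumes "\<And>x. x \<in> G \<Longrightarrow> p < x"
  shows "incidence G (insert p G) = 1"
proof -
  have "p \<notin> G" using assms by blast
  then have G: "insert p G - {p} = G" by blast
  have "{l \<in> insert p G. l \<le> p} = {p}"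
    using assms by force
  then have "eps p (insert p G) = 1"
    by (simp add: eps_def)
  then show ?thesis
    using incidence_remove[of p "insert p G"] G by simp
qed

text \<open>A new least element raises the rank of every other element by one, which flips the sign.
  Hence the minus sign of the lower right block.\<close>

lemma incidence_insert_insert:
  assumes "finite G" and G: "\<And>x. x \<in> G \<Longrightarrow> p < x" and H: "\<And>x. x \<in> H \<Longrightarrow> p < x"
  shows "incidence (insert p H) (insert p G) = - incidence H G"
proof (cases "\<exists>j\<in>G. G - {j} = H")
  case True
  then obtain j where j: "j \<in> G" "G - {j} = H" by blast
  have "p \<notin> G" "p \<notin> H" using G H by blast+
  then have "insert p G - {j} = insert p H" using j by blast
  then have "incidence (insert p H) (insert p G) = eps j (insert p G)"
    using incidence_remove[of j "insert p G"] j by simp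
  moreover have "{l \<in> insert p G. l \<le> j} = insert p {l \<in> G. l \<le> j}" "p \<notin> {l \<in> G. l \<le> j}"
    using G j by force+
  then have "eps j (insert p G) = - eps j G"
    using \<open>finite G\<close> by (simp add: eps_def)
  ultimately show ?thesis
    using incidence_remove[of j G] j by simp
next
  case False
  then have "incidence H G = 0" by (intro incidence_eq_0) blast
  moreover have "incidence (insert p H) (insert p G) = 0"
  proof (rule incidence_eq_0)
    fix j assume "j \<in> insert p G"
    have p: "p \<notin> G" "p \<notin> H" using G H by blast+
    show "insert p G - {j} \<noteq> insert p H"
    proof
      assume e: "insert p G - {j} = insert p H"
      then have "j \<noteq> p" by blast
      then have "j \<in> G" using \<open>j \<in> insert p G\<close> by blast
      moreover have "G - {j} = insert p G - {j} - {p}" using p by blast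
      then have "G - {j} = H" unfolding e using p by blast
      ultimately show False using False by blast
    qed
  qed
  ultimately show ?thesis by simp
qed

text \<open>Removing the larger element leaves the rank of the smaller one alone, whereas removing
  the smaller lowers the rank of the larger by one.\<close>

lemma eps_remove_swap:
  assumes F: "finite F" and j: "j \<in> F" and l: "l \<in> F" and ne: "j \<noteq> l"
  shows "eps l (F - {j}) * eps j F = - (eps j (F - {l}) * eps l F)"
proof -
  have *: "eps l (F - {j}) * eps j F = - (eps j (F - {l}) * eps l F)"
    if "j \<in> F" "l \<in> F" "l < j" for j l
  proof -
    have "{x \<in> F - {j}. x \<le> l} = {x \<in> F. x \<le> l}" using that by auto
    moreover have "{x \<in> F. x \<le> j} = insert l {x \<in> F - {l}. x \<le> j}" using that by auto
    moreover have "card (insert l {x \<in> F - {l}. x \<le> j}) = Suc (card {x \<in> F - {l}. x \<le> j})"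
      using F by (subst card_insert_disjoint) auto
    ultimately show ?thesis by (simp add: eps_def)
  qed
  show ?thesis
    using *[of j l] *[of l j] assms by (cases "l < j") auto
qed

lemma sum_incidence_remove:
  assumes F: "finite F"
  shows "(\<Sum>j\<in>F. incidence H (F - {j}) * eps j F) = 0"
proof -
  \<comment> \<open>The pair (j, l) stands for removing j first and l second. Exchanging the two
    reverses the sign, so the double sum is its own negative.\<close>
  define g where "g j l = (if l \<noteq> j \<and> F - {j} - {l} = H then eps l (F - {j}) * eps j F else 0)" for j l
  have "incidence H (F - {j}) * eps j F = (\<Sum>l\<in>F. g j l)" for j
  proof -
    have "incidence H (F - {j}) * eps j F = (\<Sum>l | l \<in> F \<and> l \<noteq> j \<and> F - {j} - {l} = H. g j l)"
      unfolding incidence_def sum_distrib_right by (rule sum.cong) (auto simp: g_def)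
    also have "\<dots> = (\<Sum>l\<in>F. g j l)"
      by (rule sum.mono_neutral_left) (use F in \<open>auto simp: g_def\<close>)
    finally show ?thesis .
  qed
  then have 1: "(\<Sum>j\<in>F. incidence H (F - {j}) * eps j F) = (\<Sum>j\<in>F. \<Sum>l\<in>F. g j l)"
    by simp
  have "g j l = - g l j" if "j \<in> F" "l \<in> F" for j l
  proof -
    have "F - {j} - {l} = F - {l} - {j}" by blast
    then show ?thesis
      using eps_remove_swap[OF F that] by (auto simp: g_def)
  qed
  then have "(\<Sum>j\<in>F. \<Sum>l\<in>F. g j l) = (\<Sum>j\<in>F. \<Sum>l\<in>F. - g l j)"
    by (intro sum.cong refl)
  also have "\<dots> = (\<Sum>l\<in>F. \<Sum>j\<in>F. - g l j)"
    by (rule sum.swap)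
  also have "\<dots> = - (\<Sum>j\<in>F. \<Sum>l\<in>F. g j l)"
    unfolding sum_negf ..
  finally show ?thesis unfolding 1 by linarith
qed

text \<open>Boundary squared is zero. Members of GG that are not facets of F contribute 0, so GG can
  be the whole index set of a matrix.\<close>

lemma sum_incidence_incidence:
  assumes F: "finite F" and GG: "finite GG" "\<And>j. j \<in> F \<Longrightarrow> F - {j} \<in> GG"
  shows "(\<Sum>G\<in>GG. incidence H G * incidence G F) = 0"
proof -
  have inj: "inj_on (\<lambda>j. F - {j}) F" by (rule inj_onI) blast
  have "(\<Sum>G\<in>GG. incidence H G * incidence G F) = (\<Sum>G\<in>(\<lambda>j. F - {j}) ` F. incidence H G * incidence G F)"
    by (rule sum.mono_neutral_right) (use GG in \<open>auto intro!: incidence_eq_0\<close>)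
  also have "\<dots> = (\<Sum>j\<in>F. incidence H (F - {j}) * eps j F)"
    by (subst sum.reindex[OF inj]) (auto intro!: sum.cong simp: incidence_remove)
  finally show ?thesis using sum_incidence_remove[OF F] by simp
qed

text \<open>The coefficient in top dimension. In lower dimensions the boundary matrix is an iterated
  \<open>uparrow\<close> of this one, so the recursion can ignore the dimension of the ambient
  complex.\<close>

definition wcoeff :: "int set \<Rightarrow> int set \<Rightarrow> ratfun" where
  "wcoeff G F = of_int (incidence G F) * (xm (mset_set F) / uparrow (xm (mset_set G)))"

definition wmat :: "int set list \<Rightarrow> int set list \<Rightarrow> ratfun mat" where
  "wmat gs fs = mat (length gs) (length fs) (\<lambda>(r, c). wcoeff (gs ! r) (fs ! c))"

lemma wmat_carrier [simp]: "wmat gs fs \<in> carrier_mat (length gs) (length fs)"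
  and dim_wmat [simp]: "dim_row (wmat gs fs) = length gs" "dim_col (wmat gs fs) = length fs"
  by (simp_all add: wmat_def)

lemma sum_nth_distinct:
  assumes "distinct xs"
  shows "(\<Sum>k = 0..<length xs. f (xs ! k)) = (\<Sum>x\<in>set xs. f x)"
  unfolding atLeast0LessThan by (rule sum.reindex_bij_betw[OF bij_betw_nth[OF assms refl refl]])

lemma wmat_mult_transpose_index:
  assumes "distinct fs" "r < length gs" "c < length gs"
  shows "(wmat gs fs * (wmat gs fs)\<^sup>T) $$ (r, c) = (\<Sum>F\<in>set fs. wcoeff (gs ! r) F * wcoeff (gs ! c) F)"
proof -
  have "(wmat gs fs * (wmat gs fs)\<^sup>T) $$ (r, c)
      = (\<Sum>k = 0..<length fs. wcoeff (gs ! r) (fs ! k) * wcoeff (gs ! c) (fs ! k))"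
    using assms by (simp add: wmat_def scalar_prod_def)
  then show ?thesis
    unfolding sum_nth_distinct[OF assms(1), of "\<lambda>F. wcoeff (gs ! r) F * wcoeff (gs ! c) F"] .
qed

lemma wmat_transpose_mult_index:
  assumes "distinct gs" "r < length fs" "c < length fs"
  shows "((wmat gs fs)\<^sup>T * wmat gs fs) $$ (r, c) = (\<Sum>G\<in>set gs. wcoeff G (fs ! r) * wcoeff G (fs ! c))"
proof -
  have "((wmat gs fs)\<^sup>T * wmat gs fs) $$ (r, c)
      = (\<Sum>k = 0..<length gs. wcoeff (gs ! k) (fs ! r) * wcoeff (gs ! k) (fs ! c))"
    using assms by (simp add: wmat_def scalar_prod_def)
  then show ?thesis
    unfolding sum_nth_distinct[OF assms(1), of "\<lambda>G. wcoeff G (fs ! r) * wcoeff G (fs ! c)"] .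
qed

definition facets :: "int set set \<Rightarrow> int set set" where
  "facets \<F> = {F - {j} | F j. F \<in> \<F> \<and> j \<in> F}"

lemma wcoeff_eq_0:
  assumes "F \<in> \<F>" "G \<notin> facets \<F>"
  shows "wcoeff G F = 0"
proof -
  have "incidence G F = 0"
    by (rule incidence_eq_0) (use assms in \<open>unfold facets_def, blast\<close>)
  then show ?thesis by (simp add: wcoeff_def)
qed

text \<open>The quantifiers over the lists allow a spectrum computed in the block order to be used
  for \<open>face_list\<close>. Rows outside the facets are zero and affect only the multiplicity of
  0.\<close>

definition has_spectrum :: "int set set \<Rightarrow> ratfun multiset \<Rightarrow> bool" where
  "has_spectrum \<F> V \<longleftrightarrow> (\<forall>gs fs. distinct gs \<longrightarrow> distinct fs \<longrightarrow> set fs = \<F> \<longrightarrow> facets \<F> \<subseteq> set gs \<longrightarrow>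
     spectral (wmat gs fs * (wmat gs fs)\<^sup>T) V)"

text \<open>By \<open>spectral_mult_commute\<close> the spectrum of \<open>w w\<^sup>T\<close> is that of \<open>w\<^sup>T w\<close>, in which the rows of
  \<open>w\<close> outside \<open>facets \<F>\<close> and their order play no role.\<close>

lemma has_spectrumI:
  assumes gs: "distinct gs" "facets \<F> \<subseteq> set gs" and fs: "distinct fs" "set fs = \<F>"
    and S: "spectral (wmat gs fs * (wmat gs fs)\<^sup>T) V"
  shows "has_spectrum \<F> V"
  unfolding has_spectrum_def
proof (intro allI impI)
  fix gs' fs' assume gs': "distinct gs'" "facets \<F> \<subseteq> set gs'" and fs': "distinct fs'" "set fs' = \<F>"
  have facets: "(\<Sum>G\<in>set gs. wcoeff G F * wcoeff G F') = (\<Sum>G\<in>facets \<F>. wcoeff G F * wcoeff G F')"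
    if "facets \<F> \<subseteq> set gs" "F \<in> \<F>" for gs F F'
    by (rule sum.mono_neutral_right) (use that wcoeff_eq_0[of F \<F>] in auto)
  have "(wmat gs fs)\<^sup>T * wmat gs fs = (wmat gs' fs)\<^sup>T * wmat gs' fs"
  proof (rule eq_matI)
    fix r c assume "r < dim_row ((wmat gs' fs)\<^sup>T * wmat gs' fs)" "c < dim_col ((wmat gs' fs)\<^sup>T * wmat gs' fs)"
    then have rc: "r < length fs" "c < length fs" by simp_all
    then have "fs ! r \<in> \<F>" using fs(2) nth_mem by blast
    then show "((wmat gs fs)\<^sup>T * wmat gs fs) $$ (r, c) = ((wmat gs' fs)\<^sup>T * wmat gs' fs) $$ (r, c)"
      unfolding wmat_transpose_mult_index[OF gs(1) rc] wmat_transpose_mult_index[OF gs'(1) rc]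
      by (simp only: facets[OF gs(2)] facets[OF gs'(2)])
  qed auto
  moreover have columns: "wmat gs' fs * (wmat gs' fs)\<^sup>T = wmat gs' fs' * (wmat gs' fs')\<^sup>T"
  proof (rule eq_matI)
    fix r c assume "r < dim_row (wmat gs' fs' * (wmat gs' fs')\<^sup>T)" "c < dim_col (wmat gs' fs' * (wmat gs' fs')\<^sup>T)"
    then have rc: "r < length gs'" "c < length gs'" by simp_all
    show "(wmat gs' fs * (wmat gs' fs)\<^sup>T) $$ (r, c) = (wmat gs' fs' * (wmat gs' fs')\<^sup>T) $$ (r, c)"
      unfolding wmat_mult_transpose_index[OF fs(1) rc] wmat_mult_transpose_index[OF fs'(1) rc] fs(2) fs'(2) ..
  qed auto
  moreover have "spectral ((wmat gs fs)\<^sup>T * wmat gs fs) V"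
    by (rule spectral_mult_commute[OF _ _ S]) (auto simp: wmat_def)
  ultimately have "spectral ((wmat gs' fs)\<^sup>T * wmat gs' fs) V" by simp
  then have "spectral (wmat gs' fs * (wmat gs' fs)\<^sup>T) V"
    by (rule spectral_mult_commute[rotated 2]) (auto simp: wmat_def)
  then show "spectral (wmat gs' fs' * (wmat gs' fs')\<^sup>T) V" unfolding columns .
qed

lemma has_spectrumD:
  assumes "has_spectrum \<F> V" "distinct gs" "distinct fs" "set fs = \<F>" "facets \<F> \<subseteq> set gs"
  shows "spectral (wmat gs fs * (wmat gs fs)\<^sup>T) V"
  using assms by (simp add: has_spectrum_def)

lemma has_spectrum_trivial:
  assumes "facets \<F> = {}" "finite \<F>"
  shows "has_spectrum \<F> {#}"
proof -
  obtain fs where fs: "set fs = \<F>" "distinct fs"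
    using finite_distinct_list[OF assms(2)] by blast
  have "wmat [] fs * (wmat [] fs)\<^sup>T \<in> carrier_mat 0 0" by (simp add: wmat_def carrier_matI)
  then have "spectral (wmat [] fs * (wmat [] fs)\<^sup>T) {#}"
    by (simp add: spectral_def char_poly_def det_dim_zero char_poly_matrix_def)
  with fs show ?thesis
    by (intro has_spectrumI[of "[]" _ fs]) (use assms in auto)
qed

section \<open>The recursion for shifted families\<close>

text \<open>For F = p \<union> G the numerator is \<open>xv 1 p\<close> times the denominator, so
  the weight no longer depends on G.\<close>

lemma wcoeff_insert_min:
  assumes "finite G" "finite G'" and G: "\<And>x. x \<in> G \<Longrightarrow> p < x" and G': "\<And>x. x \<in> G' \<Longrightarrow> p < x"
  shows "wcoeff G (insert p G') = (if G = G' then xv 1 p else 0)"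
proof (cases "G = G'")
  case True
  have "p \<notin> G" using G by blast
  then have "mset_set (insert p G) = add_mset p (mset_set G)"
    using \<open>finite G\<close> by simp
  moreover have "xm (add_mset p (mset_set G)) = xv 1 p * uparrow (xm (mset_set G))"
    by (rule xm_add_min) (use G \<open>finite G\<close> in \<open>auto intro: less_imp_le\<close>)
  moreover have "incidence G (insert p G) = 1"
    by (rule incidence_insert_min) (fact G)
  ultimately show ?thesis
    using True by (simp add: wcoeff_def)
next
  case False
  have "incidence G (insert p G') = 0"
  proof (rule incidence_eq_0)
    fix j assume "j \<in> insert p G'"
    have p: "p \<notin> G" "p \<notin> G'" using G G' by blast+
    show "insert p G' - {j} \<noteq> G"
    proof
      assume e: "insert p G' - {j} = G"
      then have "j = p" using p by blast
      then have "insert p G' - {j} = G'" using p by blast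
      then show False using e False by simp
    qed
  qed
  then show ?thesis using False by (simp add: wcoeff_def)
qed

lemma wcoeff_insert_eq_0:
  assumes "p \<notin> F"
  shows "wcoeff (insert p H) F = 0"
proof -
  have "incidence (insert p H) F = 0"
    by (rule incidence_eq_0) (use assms in blast)
  then show ?thesis by (simp add: wcoeff_def)
qed

text \<open>The numerator gains \<open>xv 1 p\<close>, the denominator, being shifted, gains
  \<open>xv 2 p\<close>, and the remaining entries shift by one place. The sign is that of
  \<open>incidence_insert_insert\<close>.\<close>

lemma wcoeff_insert_insert:
  assumes "finite G" "finite H" and G: "\<And>x. x \<in> G \<Longrightarrow> p < x" and H: "\<And>x. x \<in> H \<Longrightarrow> p < x"
  shows "wcoeff (insert p H) (insert p G) = - (xv 1 p / xv 2 p * uparrow (wcoeff H G))"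
proof -
  have p: "p \<notin> G" "p \<notin> H" using G H by blast+
  have "xm (add_mset p (mset_set G)) = xv 1 p * uparrow (xm (mset_set G))"
    by (rule xm_add_min) (use G \<open>finite G\<close> in \<open>auto intro: less_imp_le\<close>)
  moreover have "xm (add_mset p (mset_set H)) = xv 1 p * uparrow (xm (mset_set H))"
    by (rule xm_add_min) (use H \<open>finite H\<close> in \<open>auto intro: less_imp_le\<close>)
  moreover have "incidence (insert p H) (insert p G) = - incidence H G"
    by (rule incidence_insert_insert) (use assms in auto)
  moreover have "uparrow (xv 1 p) = xv 2 p"
    by (simp add: uparrow_xv numeral_2_eq_2)
  moreover have "mset_set (insert p G) = add_mset p (mset_set G)" "mset_set (insert p H) = add_mset p (mset_set H)"
    using p assms by simp_all
  ultimately show ?thesis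
    by (simp add: wcoeff_def uparrow_mult uparrow.hom_inverse divide_inverse uparrow.hom_of_int)
qed

text \<open>The list \<open>ls\<close> indexes both the ridges without p and, after adding p, the
  faces with p. Using one order for both makes the upper right block scalar.\<close>

lemma wmat_cone:
  fixes p :: int and ds ls hs :: "int set list"
  defines "n \<equiv> length ls" and "m \<equiv> length hs"
  defines "B \<equiv> (xv 1 p / xv 2 p) \<cdot>\<^sub>m map_mat uparrow (wmat hs ls)"
  assumes ls: "distinct ls" "\<And>G. G \<in> set ls \<Longrightarrow> finite G \<and> (\<forall>x\<in>G. p < x)"
    and hs: "\<And>G. G \<in> set hs \<Longrightarrow> finite G \<and> (\<forall>x\<in>G. p < x)"
    and ds: "\<And>F. F \<in> set ds \<Longrightarrow> p \<notin> F"
  shows "wmat (ls @ map (insert p) hs) (ds @ map (insert p) ls)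
    = four_block_mat (wmat ls ds) (xv 1 p \<cdot>\<^sub>m 1\<^sub>m n) (0\<^sub>m m (length ds)) (- B)" (is "?L = ?R")
proof (rule eq_matI)
  fix r c assume "r < dim_row ?R" "c < dim_col ?R"
  then have r: "r < n + m" and c: "c < length ds + n"
    by (simp_all add: n_def m_def B_def)
  consider "r < n" "c < length ds" | "r < n" "length ds \<le> c" | "n \<le> r" "c < length ds" | "n \<le> r" "length ds \<le> c"
    by linarith
  then show "?L $$ (r, c) = ?R $$ (r, c)"
  proof cases
    case 1
    then show ?thesis by (simp add: wmat_def n_def m_def B_def nth_append)
  next
    case 2
    define c' where "c' = c - length ds"
    have c': "c = length ds + c'" "c' < n" using 2 c by (simp_all add: c'_def)
    have "ls ! r \<in> set ls" "ls ! c' \<in> set ls" using 2 c' by (simp_all add: n_def)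
    then have "wcoeff (ls ! r) (insert p (ls ! c')) = (if ls ! r = ls ! c' then xv 1 p else 0)"
      by (intro wcoeff_insert_min) (use ls in auto)
    moreover have "ls ! r = ls ! c' \<longleftrightarrow> r = c'"
      using ls(1) 2 c' by (simp add: n_def nth_eq_iff_index_eq)
    ultimately show ?thesis
      using 2 c' by (simp add: wmat_def n_def m_def B_def nth_append)
  next
    case 3
    define r' where "r' = r - n"
    have r': "r = n + r'" "r' < m" using 3 r by (simp_all add: r'_def)
    have "ds ! c \<in> set ds" using 3 by simp
    then have "wcoeff (insert p (hs ! r')) (ds ! c) = 0"
      by (intro wcoeff_insert_eq_0 ds)
    then show ?thesis
      using 3 r' by (simp add: wmat_def n_def m_def B_def nth_append)
  next
    case 4
    define r' c' where "r' = r - n" and "c' = c - length ds"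
    have r': "r = n + r'" "r' < m" and c': "c = length ds + c'" "c' < n"
      using 4 r c by (simp_all add: r'_def c'_def)
    have "hs ! r' \<in> set hs" "ls ! c' \<in> set ls" using r' c' by (simp_all add: n_def m_def)
    then have "wcoeff (insert p (hs ! r')) (insert p (ls ! c')) = - (xv 1 p / xv 2 p * uparrow (wcoeff (hs ! r') (ls ! c')))"
      by (intro wcoeff_insert_insert) (use ls hs in auto)
    then show ?thesis
      using 4 r' c' by (simp add: wmat_def n_def m_def B_def nth_append)
  qed
qed (simp_all add: n_def m_def B_def)

text \<open>Shifting the left factor turns its numerator \<open>xm G\<close> into the denominator of
  the right factor. The weights telescope to a factor independent of the middle set G, and the
  unweighted sum vanishes.\<close>

lemma wmat_mult_wmat:
  assumes ls: "distinct ls" and fin: "\<And>F. F \<in> set ds \<Longrightarrow> finite F" and ds: "facets (set ds) \<subseteq> set ls"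
  shows "map_mat uparrow (wmat hs ls) * wmat ls ds = 0\<^sub>m (length hs) (length ds)"
proof (rule eq_matI)
  fix r c assume "r < dim_row (0\<^sub>m (length hs) (length ds) :: ratfun mat)" "c < dim_col (0\<^sub>m (length hs) (length ds) :: ratfun mat)"
  then have rc: "r < length hs" "c < length ds" by simp_all
  define H F where "H = hs ! r" and "F = ds ! c"
  have F: "F \<in> set ds" using rc by (simp add: F_def)
  have "(map_mat uparrow (wmat hs ls) * wmat ls ds) $$ (r, c)
      = (\<Sum>k = 0..<length ls. uparrow (wcoeff H (ls ! k)) * wcoeff (ls ! k) F)"
    using rc by (simp add: wmat_def scalar_prod_def H_def F_def)
  also have "\<dots> = (\<Sum>G\<in>set ls. uparrow (wcoeff H G) * wcoeff G F)"
    by (rule sum_nth_distinct[OF ls])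
  also have "\<dots> = (\<Sum>G\<in>set ls. of_int (incidence H G * incidence G F)
      * (xm (mset_set F) / uparrow (uparrow (xm (mset_set H)))))"
    by (intro sum.cong refl)
      (simp add: wcoeff_def uparrow_mult uparrow.hom_inverse divide_inverse uparrow.hom_of_int)
  also have "\<dots> = of_int (\<Sum>G\<in>set ls. incidence H G * incidence G F)
      * (xm (mset_set F) / uparrow (uparrow (xm (mset_set H))))"
    unfolding of_int_sum sum_distrib_right ..
  also have "(\<Sum>G\<in>set ls. incidence H G * incidence G F) = 0"
    by (rule sum_incidence_incidence) (use F fin ds in \<open>auto simp: facets_def\<close>)
  finally show "(map_mat uparrow (wmat hs ls) * wmat ls ds) $$ (r, c) = 0\<^sub>m (length hs) (length ds) $$ (r, c)"
    using rc by simp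
qed simp_all

text \<open>The faces of a single dimension, with p only as a lower bound: p need not occur in any
  member. So deletion and link remain in the class with the bound p + 1, whether or not p + 1 is a
  vertex.\<close>

definition shifted_family :: "int \<Rightarrow> nat \<Rightarrow> int set set \<Rightarrow> bool" where
  "shifted_family p k \<F> \<longleftrightarrow> finite \<F> \<and>
     (\<forall>F\<in>\<F>. finite F \<and> card F = k \<and> (\<forall>x\<in>F. p \<le> x) \<and>
       (\<forall>i j. p \<le> i \<longrightarrow> i < j \<longrightarrow> i \<notin> F \<longrightarrow> j \<in> F \<longrightarrow> insert i (F - {j}) \<in> \<F>))"

definition avoiding :: "int \<Rightarrow> int set set \<Rightarrow> int set set" where
  "avoiding p \<F> = {F \<in> \<F>. p \<notin> F}"

definition containing :: "int \<Rightarrow> int set set \<Rightarrow> int set set" where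
  "containing p \<F> = {F \<in> \<F>. p \<in> F}"

definition star_base :: "int \<Rightarrow> int set set \<Rightarrow> int set set" where
  "star_base p \<F> = {G. p \<notin> G \<and> insert p G \<in> \<F>}"

lemma shifted_familyD:
  assumes "shifted_family p k \<F>" "F \<in> \<F>"
  shows "finite F" "card F = k" "\<And>x. x \<in> F \<Longrightarrow> p \<le> x"
    "\<And>i j. p \<le> i \<Longrightarrow> i < j \<Longrightarrow> i \<notin> F \<Longrightarrow> j \<in> F \<Longrightarrow> insert i (F - {j}) \<in> \<F>"
  using assms by (auto simp: shifted_family_def)

lemma star_base_bij:
  "bij_betw (insert p) (star_base p \<F>) (containing p \<F>)"
  unfolding bij_betw_def
proof
  show "inj_on (insert p) (star_base p \<F>)"
    by (rule inj_onI) (metis CollectD insert_ident star_base_def)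
  have "F \<in> insert p ` star_base p \<F>" if "F \<in> \<F>" "p \<in> F" for F
    by (rule image_eqI[of _ _ "F - {p}"]) (use that in \<open>auto simp: star_base_def insert_absorb\<close>)
  then show "insert p ` star_base p \<F> = containing p \<F>"
    by (auto simp: star_base_def containing_def)
qed

lemma finite_star_base: "finite \<F> \<Longrightarrow> finite (star_base p \<F>)"
  using bij_betw_finite[OF star_base_bij[of p \<F>]] by (simp add: containing_def)

lemma shifted_family_avoiding:
  assumes "shifted_family p k \<F>"
  shows "shifted_family (p + 1) k (avoiding p \<F>)"
  unfolding shifted_family_def
proof (intro conjI ballI allI impI)
  show "finite (avoiding p \<F>)" using assms by (simp add: shifted_family_def avoiding_def)
  fix F assume "F \<in> avoiding p \<F>"
  then have F: "F \<in> \<F>" "p \<notin> F" by (auto simp: avoiding_def)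
  note D = shifted_familyD[OF assms F(1)]
  show "finite F" "card F = k" by (fact D)+
  show "p + 1 \<le> x" if "x \<in> F" for x
    using D(3)[OF that] that F(2) by (cases "x = p") auto
  fix i j assume "p + 1 \<le> i" "i < j" "i \<notin> F" "j \<in> F"
  then show "insert i (F - {j}) \<in> avoiding p \<F>"
    using D(4)[of i j] F(2) by (auto simp: avoiding_def)
qed

lemma shifted_family_star_base:
  assumes "shifted_family p (Suc k) \<F>"
  shows "shifted_family (p + 1) k (star_base p \<F>)"
  unfolding shifted_family_def
proof (intro conjI ballI allI impI)
  show "finite (star_base p \<F>)" using assms by (intro finite_star_base) (simp add: shifted_family_def)
  fix G assume "G \<in> star_base p \<F>"
  then have G: "insert p G \<in> \<F>" "p \<notin> G" by (auto simp: star_base_def)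
  note D = shifted_familyD[OF assms G(1)]
  show fin: "finite G" using D(1) by simp
  show "card G = k" using D(2) fin G(2) by simp
  show "p + 1 \<le> x" if "x \<in> G" for x
    using D(3)[of x] that G(2) by (cases "x = p") auto
  fix i j assume ij: "p + 1 \<le> i" "i < j" "i \<notin> G" "j \<in> G"
  have "insert i (insert p G - {j}) \<in> \<F>"
    by (rule D(4)) (use ij in auto)
  moreover have "insert i (insert p G - {j}) = insert p (insert i (G - {j}))"
    using ij(4) G(2) by blast
  ultimately show "insert i (G - {j}) \<in> star_base p \<F>"
    using G(2) ij by (simp add: star_base_def)
qed

text \<open>The element j removed from F can be replaced by p, so F - {j} together with p is again a
  member.\<close>

lemma facets_avoiding:
  assumes "shifted_family p k \<F>"
  shows "facets (avoiding p \<F>) \<subseteq> star_base p \<F>"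
proof
  fix G assume "G \<in> facets (avoiding p \<F>)"
  then obtain F j where F: "F \<in> \<F>" "p \<notin> F" "j \<in> F" "G = F - {j}"
    by (auto simp: facets_def avoiding_def)
  note D = shifted_familyD[OF assms F(1)]
  have "p < j" using D(3)[OF F(3)] F(2,3) by (cases "p = j") auto
  then have "insert p (F - {j}) \<in> \<F>" by (intro D(4)) (use F in auto)
  then show "G \<in> star_base p \<F>" using F by (simp add: star_base_def)
qed

lemma facets_subset_star:
  assumes "shifted_family p k \<F>"
  shows "facets \<F> \<subseteq> star_base p \<F> \<union> insert p ` facets (star_base p \<F>)"
proof
  fix G assume "G \<in> facets \<F>"
  then obtain F j where F: "F \<in> \<F>" "j \<in> F" "G = F - {j}"
    by (auto simp: facets_def)
  consider "p \<notin> F" | "p \<in> F" "j = p" | "p \<in> F" "j \<noteq> p" by blast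
  then show "G \<in> star_base p \<F> \<union> insert p ` facets (star_base p \<F>)"
  proof cases
    case 1
    then have "G \<in> facets (avoiding p \<F>)" using F by (auto simp: facets_def avoiding_def)
    then show ?thesis using facets_avoiding[OF assms] by blast
  next
    case 2
    then show ?thesis using F by (simp add: star_base_def insert_absorb)
  next
    case 3
    have "F - {p} \<in> star_base p \<F>" using 3 F by (simp add: star_base_def insert_absorb)
    moreover have "G = insert p (F - {p} - {j})" "j \<in> F - {p}" using 3 F by blast+
    ultimately show ?thesis unfolding facets_def by blast
  qed
qed

lemma has_spectrum_cone:
  assumes \<F>: "shifted_family p (Suc k) \<F>"
    and V: "has_spectrum (avoiding p \<F>) V" and W: "has_spectrum (star_base p \<F>) W"
    and size: "size V + size W \<le> card (star_base p \<F>)"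
  shows "has_spectrum \<F> (image_mset ((+) ((xv 1 p)\<^sup>2)) (V + image_mset (\<lambda>w. (xv 1 p / xv 2 p)\<^sup>2 * uparrow w) W)
    + replicate_mset (card (star_base p \<F>) - size V - size W) ((xv 1 p)\<^sup>2))"
proof -
  let ?D = "avoiding p \<F>" and ?L = "star_base p \<F>"
  note D = shifted_family_avoiding[OF \<F>] and L = shifted_family_star_base[OF \<F>]
  have fin: "finite ?D" "finite ?L" using D L by (simp_all add: shifted_family_def)
  have facets: "facets ?L = (\<lambda>(F, j). F - {j}) ` (SIGMA F:?L. F)"
    unfolding facets_def by force
  have "finite (facets ?L)"
    unfolding facets by (intro finite_imageI finite_SigmaI fin) (use shifted_familyD(1)[OF L] in auto)
  then obtain ds ls hs where ds: "set ds = ?D" "distinct ds" and ls: "set ls = ?L" "distinct ls"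
    and hs: "set hs = facets ?L" "distinct hs"
    using finite_distinct_list fin by metis
  define n m a A B where "n = length ls" and "m = length hs" and "a = xv 1 p" and "A = wmat ls ds"
    and "B = (xv 1 p / xv 2 p) \<cdot>\<^sub>m map_mat uparrow (wmat hs ls)"
  let ?gs = "ls @ map (insert p) hs" and ?fs = "ds @ map (insert p) ls"
  have A: "A \<in> carrier_mat n (length ds)" and B: "B \<in> carrier_mat m n"
    by (simp_all add: A_def B_def n_def m_def)
  have Lp: "finite G \<and> (\<forall>x\<in>G. p < x)" if "G \<in> ?L" for G
  proof (intro conjI ballI)
    show "finite G" by (rule shifted_familyD(1)[OF L that])
    show "p < x" if "x \<in> G" for x
      using shifted_familyD(3)[OF L \<open>G \<in> ?L\<close> that] by simp
  qed
  have Hp: "finite G \<and> (\<forall>x\<in>G. p < x)" if "G \<in> facets ?L" for G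
    using Lp that by (auto simp: facets_def)
  have Lp': "p \<notin> G" if "G \<in> ?L" for G using that by (simp add: star_base_def)
  have Hp': "p \<notin> G" if "G \<in> facets ?L" for G using Hp[OF that] by blast
  have W_eq: "wmat ?gs ?fs = four_block_mat A (a \<cdot>\<^sub>m 1\<^sub>m n) (0\<^sub>m m (length ds)) (- B)"
    unfolding A_def a_def B_def n_def m_def
    by (rule wmat_cone) (use ls hs ds Lp Hp in \<open>auto simp: avoiding_def\<close>)
  have BA: "B * A = 0\<^sub>m m (length ds)"
  proof -
    have "map_mat uparrow (wmat hs ls) * wmat ls ds = 0\<^sub>m (length hs) (length ds)"
      by (rule wmat_mult_wmat) (use ls ds facets_avoiding[OF \<F>] shifted_familyD(1)[OF D] in auto)
    then show ?thesis
      unfolding B_def A_def by (subst mult_smult_assoc_mat[of _ m n]) (auto simp: m_def n_def)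
  qed
  \<comment> \<open>The orthogonality that \<open>spectral_block\<close> asks for: the product is A
    times the transpose of B A.\<close>
  have AB: "A * A\<^sup>T * B\<^sup>T = 0\<^sub>m n m"
  proof -
    have "A * A\<^sup>T * B\<^sup>T = A * (A\<^sup>T * B\<^sup>T)"
      by (rule assoc_mult_mat) (use A B in auto)
    also have "A\<^sup>T * B\<^sup>T = (B * A)\<^sup>T"
      by (rule transpose_mult[symmetric, OF B A])
    finally show ?thesis using A unfolding BA by simp
  qed
  have lap: "wmat ?gs ?fs * (wmat ?gs ?fs)\<^sup>T
      = four_block_mat (A * A\<^sup>T + a\<^sup>2 \<cdot>\<^sub>m 1\<^sub>m n) (- (a \<cdot>\<^sub>m B\<^sup>T)) (- (a \<cdot>\<^sub>m B)) (B * B\<^sup>T)"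
  proof -
    have "wmat ?gs ?fs * (wmat ?gs ?fs)\<^sup>T = four_block_mat A (a \<cdot>\<^sub>m 1\<^sub>m n) (0\<^sub>m m (length ds)) (- B)
      * four_block_mat (A\<^sup>T) ((0\<^sub>m m (length ds))\<^sup>T) ((a \<cdot>\<^sub>m 1\<^sub>m n)\<^sup>T) ((- B)\<^sup>T)"
      unfolding W_eq using A B by (subst transpose_four_block_mat) auto
    also have "\<dots> = four_block_mat (A * A\<^sup>T + (a \<cdot>\<^sub>m 1\<^sub>m n) * (a \<cdot>\<^sub>m 1\<^sub>m n)\<^sup>T)
        (A * (0\<^sub>m m (length ds))\<^sup>T + (a \<cdot>\<^sub>m 1\<^sub>m n) * (- B)\<^sup>T)
        (0\<^sub>m m (length ds) * A\<^sup>T + (- B) * (a \<cdot>\<^sub>m 1\<^sub>m n)\<^sup>T)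
        (0\<^sub>m m (length ds) * (0\<^sub>m m (length ds))\<^sup>T + (- B) * (- B)\<^sup>T)"
      by (rule mult_four_block_mat) (use A B in auto)
    also have "(a \<cdot>\<^sub>m 1\<^sub>m n) * (a \<cdot>\<^sub>m 1\<^sub>m n)\<^sup>T = a\<^sup>2 \<cdot>\<^sub>m 1\<^sub>m n"
      by (auto simp: power2_eq_square intro!: eq_matI)
    also have "A * (0\<^sub>m m (length ds))\<^sup>T + (a \<cdot>\<^sub>m 1\<^sub>m n) * (- B)\<^sup>T = - (a \<cdot>\<^sub>m B\<^sup>T)"
      using A B by (auto simp: smult_mat_one_mult[of _ n m] intro!: eq_matI)
    also have "0\<^sub>m m (length ds) * A\<^sup>T + (- B) * (a \<cdot>\<^sub>m 1\<^sub>m n)\<^sup>T = - (a \<cdot>\<^sub>m B)"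
      using A B by (auto intro!: eq_matI)
    also have "0\<^sub>m m (length ds) * (0\<^sub>m m (length ds))\<^sup>T + (- B) * (- B)\<^sup>T = B * B\<^sup>T"
      using B by (auto intro!: eq_matI)
    finally show ?thesis .
  qed
  have V': "spectral (A * A\<^sup>T) V"
    unfolding A_def by (rule has_spectrumD[OF V]) (use ls ds facets_avoiding[OF \<F>] in auto)
  \<comment> \<open>B is the shifted link matrix times a scalar, so its Laplacian is the shifted
    link Laplacian times the square of that scalar; the sign of the block -B disappears in the
    product.\<close>
  have W': "spectral (B * B\<^sup>T) (image_mset (\<lambda>w. (xv 1 p / xv 2 p)\<^sup>2 * uparrow w) W)"
  proof -
    let ?B = "wmat hs ls"
    have 1: "?B * ?B\<^sup>T \<in> carrier_mat m m" by (simp add: m_def carrier_matI)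
    have "spectral (?B * ?B\<^sup>T) W"
      by (rule has_spectrumD[OF W]) (use ls hs in auto)
    then have "spectral (map_mat uparrow (?B * ?B\<^sup>T)) (image_mset uparrow W)"
      by (rule spectral_map_mat[OF uparrow.comm_ring_hom_axioms 1])
    then have "spectral ((xv 1 p / xv 2 p)\<^sup>2 \<cdot>\<^sub>m map_mat uparrow (?B * ?B\<^sup>T)) (image_mset ((*) ((xv 1 p / xv 2 p)\<^sup>2)) (image_mset uparrow W))"
      by (intro spectral_smult[of _ m]) (use 1 in auto)
    also have "(xv 1 p / xv 2 p)\<^sup>2 \<cdot>\<^sub>m map_mat uparrow (?B * ?B\<^sup>T) = B * B\<^sup>T"
    proof -
      define M where "M = map_mat uparrow ?B"
      have M: "M \<in> carrier_mat m n" by (simp add: M_def m_def n_def)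
      have "map_mat uparrow (?B * ?B\<^sup>T) = map_mat uparrow ?B * map_mat uparrow (?B\<^sup>T)"
        by (rule uparrow.mat_hom_mult[of _ m n _ m]) (simp_all add: m_def n_def)
      also have "\<dots> = M * M\<^sup>T"
        unfolding M_def by (simp only: map_mat_transpose)
      finally show ?thesis
        unfolding B_def M_def[symmetric] using M
        by (auto simp: power2_eq_square intro!: eq_matI)
    qed
    finally show ?thesis
      by (simp add: image_mset.compositionality comp_def)
  qed
  have "card ?L = n" using ls distinct_card[of ls] by (simp add: n_def)
  then have "spectral (wmat ?gs ?fs * (wmat ?gs ?fs)\<^sup>T)
    (image_mset ((+) (a\<^sup>2)) (V + image_mset (\<lambda>w. (xv 1 p / xv 2 p)\<^sup>2 * uparrow w) W) + replicate_mset (card ?L - size V - size W) (a\<^sup>2))"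
    unfolding lap using spectral_block[OF _ B AB V' W', of a] A size by simp
  moreover have "inj_on (insert p) (facets ?L)"
    by (rule inj_onI) (metis Hp' insert_ident)
  then have "distinct ?gs"
    using ls hs Lp' by (auto simp: distinct_map)
  moreover have "distinct ?fs"
    using ls ds bij_betw_imp_inj_on[OF star_base_bij[of p \<F>]] by (auto simp: distinct_map avoiding_def)
  moreover have "facets \<F> \<subseteq> set ?gs"
    using facets_subset_star[OF \<F>] ls hs by simp
  moreover have "set ?fs = \<F>"
    using ls ds bij_betw_imp_surj_on[OF star_base_bij[of p \<F>]] by (auto simp: avoiding_def containing_def)
  ultimately show ?thesis
    unfolding a_def by (intro has_spectrumI)
qed

section \<open>Eigenvalues of shifted families\<close>

text \<open>A cycle on \<open>\<L>\<close> is determined modulo the boundaries from \<open>\<D>\<close> by its coefficients on these faces.\<close>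

definition homology_faces :: "int \<Rightarrow> int set set \<Rightarrow> int set set \<Rightarrow> int set set" where
  "homology_faces q \<L> \<D> = {G \<in> \<L>. q \<notin> G \<and> insert q G \<notin> \<D>}"

text \<open>A member G of the link contains q, or G \<union> q is in the deletion, or neither. The
  second kind corresponds bijectively to the members of the deletion through q; that all such G do
  lie in the link is \<open>facets_avoiding\<close>.\<close>

lemma card_star_base:
  assumes "shifted_family p k \<F>"
  shows "card (containing q (avoiding p \<F>)) + card (containing q (star_base p \<F>))
    + card (homology_faces q (star_base p \<F>) (avoiding p \<F>)) = card (star_base p \<F>)"
proof -
  let ?D = "avoiding p \<F>" and ?L = "star_base p \<F>"
  have fin: "finite ?L" using assms by (intro finite_star_base) (simp add: shifted_family_def)
  have "star_base q ?D \<subseteq> facets ?D"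
  proof
    fix G assume "G \<in> star_base q ?D"
    then have "insert q G \<in> ?D" "G = insert q G - {q}" by (auto simp: star_base_def)
    then show "G \<in> facets ?D" unfolding facets_def by blast
  qed
  then have sub: "star_base q ?D \<subseteq> ?L" using facets_avoiding[OF assms] by blast
  have fin': "finite (star_base q ?D)" "finite (containing q ?L)" "finite (homology_faces q ?L ?D)"
    using fin finite_subset[OF sub fin] by (simp_all add: containing_def homology_faces_def)
  have "?L = star_base q ?D \<union> (containing q ?L \<union> homology_faces q ?L ?D)"
    using sub by (auto simp: containing_def homology_faces_def star_base_def)
  moreover have "card (star_base q ?D \<union> (containing q ?L \<union> homology_faces q ?L ?D))
      = card (star_base q ?D) + card (containing q ?L \<union> homology_faces q ?L ?D)"
    using fin'
    by (intro card_Un_disjoint) (auto simp: containing_def homology_faces_def star_base_def)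
  moreover have "card (containing q ?L \<union> homology_faces q ?L ?D)
      = card (containing q ?L) + card (homology_faces q ?L ?D)"
    using fin' by (intro card_Un_disjoint) (auto simp: containing_def homology_faces_def)
  moreover have "card (star_base q ?D) = card (containing q ?D)"
    by (rule bij_betw_same_card[OF star_base_bij])
  ultimately show ?thesis by simp
qed

text \<open>Adjoining p to S and T is an operation on pairs, not on the values z(S,T), so the
  recursion is carried out on multisets of pairs.\<close>

definition cone_pairs :: "int \<Rightarrow> (int multiset \<times> int multiset) multiset \<Rightarrow>
    (int multiset \<times> int multiset) multiset \<Rightarrow> nat \<Rightarrow> (int multiset \<times> int multiset) multiset" where
  "cone_pairs p P Q r = image_mset (\<lambda>(S, T). (S, add_mset p T)) P
     + image_mset (\<lambda>(S, T). (add_mset p S, add_mset p T)) Q + replicate_mset r ({#}, {#p#})"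

abbreviation zpolys :: "(int multiset \<times> int multiset) multiset \<Rightarrow> ratfun multiset" where
  "zpolys P \<equiv> image_mset (\<lambda>(S, T). zpoly S T) P"

text \<open>A nonempty T makes the value nonzero, so that \<open>size\<close> counts nonzero
  eigenvalues; the lower bound is what the identities for adjoining p require.\<close>

definition bounded_pairs :: "int \<Rightarrow> (int multiset \<times> int multiset) multiset \<Rightarrow> bool" where
  "bounded_pairs p P \<longleftrightarrow> (\<forall>S T. (S, T) \<in># P \<longrightarrow> T \<noteq> {#} \<and> (\<forall>x\<in>#S + T. p \<le> x))"

lemma bounded_pairsD:
  assumes "bounded_pairs p P" "(S, T) \<in># P"
  shows "T \<noteq> {#}" "\<And>x. x \<in># S \<Longrightarrow> p \<le> x" "\<And>x. x \<in># T \<Longrightarrow> p \<le> x"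
  using assms by (auto simp: bounded_pairs_def)

lemma bounded_pairs_mono: "bounded_pairs q P \<Longrightarrow> p \<le> q \<Longrightarrow> bounded_pairs p P"
  unfolding bounded_pairs_def by fastforce

lemma bounded_cone_pairs:
  "bounded_pairs p P \<Longrightarrow> bounded_pairs p Q \<Longrightarrow> bounded_pairs p (cone_pairs p P Q r)"
  unfolding bounded_pairs_def cone_pairs_def by (fastforce split: if_splits)

lemma zpolys_cone_pairs:
  assumes P: "bounded_pairs p P" and Q: "bounded_pairs p Q"
  shows "zpolys (cone_pairs p P Q r)
    = image_mset ((+) ((xv 1 p)\<^sup>2)) (zpolys P + image_mset (\<lambda>w. (xv 1 p / xv 2 p)\<^sup>2 * uparrow w) (zpolys Q))
      + replicate_mset r ((xv 1 p)\<^sup>2)"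
proof -
  have "zpolys (image_mset (\<lambda>(S, T). (S, add_mset p T)) P) = image_mset ((+) ((xv 1 p)\<^sup>2)) (zpolys P)"
    unfolding image_mset.compositionality comp_def
  proof (intro image_mset_cong, clarify)
    fix S T assume "(S, T) \<in># P"
    then show "zpoly S (add_mset p T) = (xv 1 p)\<^sup>2 + zpoly S T"
      by (intro zpoly_add_min_right) (use bounded_pairsD[OF P] in blast)
  qed
  moreover have "zpolys (image_mset (\<lambda>(S, T). (add_mset p S, add_mset p T)) Q)
      = image_mset ((+) ((xv 1 p)\<^sup>2)) (image_mset (\<lambda>w. (xv 1 p / xv 2 p)\<^sup>2 * uparrow w) (zpolys Q))"
    unfolding image_mset.compositionality comp_def
  proof (intro image_mset_cong, clarify)
    fix S T assume "(S, T) \<in># Q"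
    then show "zpoly (add_mset p S) (add_mset p T) = (xv 1 p)\<^sup>2 + (xv 1 p / xv 2 p)\<^sup>2 * uparrow (zpoly S T)"
      by (intro zpoly_add_min_both) (use bounded_pairsD[OF Q] in blast)+
  qed
  moreover have "zpoly {#} {#p#} = (xv 1 p)\<^sup>2"
    using zpoly_add_min_right[of "{#}" p "{#}"] by simp
  ultimately show ?thesis
    unfolding cone_pairs_def by simp
qed

lemma has_spectrum_cone_pairs:
  assumes "shifted_family p (Suc k) \<F>"
    and "has_spectrum (avoiding p \<F>) (zpolys P)" "has_spectrum (star_base p \<F>) (zpolys Q)"
    and "bounded_pairs p P" "bounded_pairs p Q"
    and "size P + size Q \<le> card (star_base p \<F>)"
  shows "has_spectrum \<F> (zpolys (cone_pairs p P Q (card (star_base p \<F>) - size P - size Q)))"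
  using has_spectrum_cone[OF assms(1-3)] assms(6)
  unfolding zpolys_cone_pairs[OF assms(4,5)] by simp

text \<open>A member with an element could be shifted to one containing p. This is the base case of
  the recursion.\<close>

lemma facets_eq_empty:
  assumes "shifted_family p k \<F>" "containing p \<F> = {}"
  shows "facets \<F> = {}"
proof -
  have "avoiding p \<F> = \<F>" using assms(2) by (auto simp: avoiding_def containing_def)
  moreover have "star_base p \<F> = {}"
    using assms(2) bij_betw_imp_surj_on[OF star_base_bij[of p \<F>]] by blast
  ultimately show ?thesis using facets_avoiding[OF assms(1)] by simp
qed

text \<open>The deletion loses a face through p, and the link lowers k without increasing the number
  of faces, so the measure drops in both cases. The count in the conclusion, combined with
  \<open>card_star_base\<close>, bounds the sizes in the next step.\<close>

lemma shifted_family_spectrum: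
  assumes "shifted_family p k \<F>"
  shows "\<exists>P. has_spectrum \<F> (zpolys P) \<and> bounded_pairs p P \<and> size P = card (containing p \<F>)"
  using assms
proof (induction "k + card \<F>" arbitrary: p k \<F> rule: less_induct)
  case less
  note F = less.prems
  have fin: "finite \<F>" using F by (simp add: shifted_family_def)
  show ?case
  proof (cases "containing p \<F> = {}")
    case True
    have "has_spectrum \<F> (zpolys {#})"
      using has_spectrum_trivial[OF facets_eq_empty[OF F True] fin] by simp
    then show ?thesis
      using True by (intro exI[of _ "{#}"]) (simp add: bounded_pairs_def)
  next
    case False
    then obtain F0 where F0: "F0 \<in> \<F>" "p \<in> F0" by (auto simp: containing_def)
    then obtain k' where k: "k = Suc k'"
      using shifted_familyD(1,2)[OF F F0(1)] by (cases k) auto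
    let ?D = "avoiding p \<F>" and ?L = "star_base p \<F>"
    have card_L: "card ?L = card (containing p \<F>)"
      by (rule bij_betw_same_card[OF star_base_bij])
    have "k + card ?D < k + card \<F>"
      using F0 fin by (auto simp: avoiding_def intro!: psubset_card_mono)
    then obtain P where P: "has_spectrum ?D (zpolys P)" "bounded_pairs (p + 1) P"
        "size P = card (containing (p + 1) ?D)"
      using less.hyps shifted_family_avoiding[OF F] by blast
    have "card ?L \<le> card \<F>"
      unfolding card_L using fin by (intro card_mono) (auto simp: containing_def)
    then have "k' + card ?L < k + card \<F>" using k by simp
    then obtain Q where Q: "has_spectrum ?L (zpolys Q)" "bounded_pairs (p + 1) Q"
        "size Q = card (containing (p + 1) ?L)"
      using less.hyps shifted_family_star_base[OF F[unfolded k]] by blast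
    let ?r = "card ?L - size P - size Q"
    have size: "size P + size Q \<le> card ?L"
      using card_star_base[OF F, of "p + 1"] P(3) Q(3) by simp
    have PQ: "bounded_pairs p P" "bounded_pairs p Q"
      using bounded_pairs_mono P(2) Q(2) by auto
    have "has_spectrum \<F> (zpolys (cone_pairs p P Q ?r))"
      by (rule has_spectrum_cone_pairs[OF F[unfolded k] P(1) Q(1) PQ size])
    moreover have "size (cone_pairs p P Q ?r) = card (containing p \<F>)"
      using size by (simp add: cone_pairs_def flip: card_L)
    ultimately show ?thesis
      using bounded_cone_pairs[OF PQ] by blast
  qed
qed

section \<open>Homology of a shifted complex\<close>

lemma int_kernel_exists:
  fixes f :: "nat \<Rightarrow> nat \<Rightarrow> int"
  assumes "r < n"
  shows "\<exists>v. (\<exists>j<n. v j \<noteq> 0) \<and> (\<forall>i<r. (\<Sum>j<n. f i j * v j) = 0)"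
proof -
  define A where "A = mat n n (\<lambda>(i, j). if i < r then f i j else 0)"
  have A: "A \<in> carrier_mat n n" by (simp add: A_def)
  \<comment> \<open>A is the r by n system padded with zero rows to a square. Row r is zero, so
    scaling it by 0 changes nothing and det A = 0. Over the integers, as over any domain, this
    already yields a nonzero kernel vector.\<close>
  have "multrow r 0 A = A"
    by (rule eq_matI) (auto simp: A_def)
  then have "det A = 0"
    using det_multrow[OF assms A, of 0] by simp
  then obtain v where v: "v \<in> carrier_vec n" "v \<noteq> 0\<^sub>v n" "A *\<^sub>v v = 0\<^sub>v n"
    using det_0_iff_vec_prod_zero[OF A] by blast
  have "\<exists>j<n. v $ j \<noteq> 0"
  proof (rule ccontr)
    assume "\<not> ?thesis"
    then have "v = 0\<^sub>v n" using v(1) by (intro eq_vecI) auto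
    then show False using v(2) by simp
  qed
  moreover have "(\<Sum>j<n. f i j * v $ j) = 0" if "i < r" for i
  proof -
    have "(A *\<^sub>v v) $ i = (\<Sum>j<n. f i j * v $ j)"
      using that assms v(1) by (simp add: A_def scalar_prod_def atLeast0LessThan)
    then show ?thesis using v(3) that assms by simp
  qed
  ultimately show ?thesis by blast
qed

text \<open>Each element of R gives one linear equation for the coefficients, and there are more
  unknowns than equations.\<close>

lemma frag_dependent:
  fixes h :: "'b \<Rightarrow> ('a \<Rightarrow>\<^sub>0 int)"
  assumes "finite R" "finite B" "card R < card B" and h: "\<And>b. b \<in> B \<Longrightarrow> Poly_Mapping.keys (h b) \<subseteq> R"
  shows "\<exists>c. (\<exists>b\<in>B. c b \<noteq> 0) \<and> (\<Sum>b\<in>B. frag_cmul (c b) (h b)) = 0"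
proof -
  obtain rs where rs: "set rs = R" "distinct rs" using finite_distinct_list[OF \<open>finite R\<close>] by blast
  obtain \<beta> where \<beta>: "bij_betw \<beta> {..<card B} B"
    using ex_bij_betw_nat_finite[OF \<open>finite B\<close>] unfolding atLeast0LessThan by blast
  have len: "length rs = card R" using rs distinct_card by metis
  obtain v where v: "\<exists>j<card B. v j \<noteq> 0"
    "\<And>i. i < card R \<Longrightarrow> (\<Sum>j<card B. Poly_Mapping.lookup (h (\<beta> j)) (rs ! i) * v j) = 0"
    using int_kernel_exists[OF \<open>card R < card B\<close>, of "\<lambda>i j. Poly_Mapping.lookup (h (\<beta> j)) (rs ! i)"] by blast
  define c where "c b = v (inv_into {..<card B} \<beta> b)" for b
  have c: "c (\<beta> j) = v j" if "j < card B" for j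
    using that bij_betw_inv_into_left[OF \<beta>] by (simp add: c_def)
  have "(\<Sum>b\<in>B. c b * Poly_Mapping.lookup (h b) x) = 0" for x
  proof (cases "x \<in> R")
    case True
    then obtain i where i: "i < card R" "rs ! i = x" using rs len by (metis in_set_conv_nth)
    have "(\<Sum>b\<in>B. c b * Poly_Mapping.lookup (h b) x)
        = (\<Sum>j<card B. c (\<beta> j) * Poly_Mapping.lookup (h (\<beta> j)) x)"
      by (rule sum.reindex_bij_betw[OF \<beta>, symmetric])
    also have "\<dots> = (\<Sum>j<card B. Poly_Mapping.lookup (h (\<beta> j)) x * v j)"
      by (rule sum.cong) (simp_all add: c)
    finally show ?thesis using v(2)[OF i(1)] i(2) by simp
  next
    case False
    then have "Poly_Mapping.lookup (h b) x = 0" if "b \<in> B" for b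
      using h[OF that] by (meson in_keys_iff subsetD)
    then show ?thesis by simp
  qed
  then have "(\<Sum>b\<in>B. frag_cmul (c b) (h b)) = 0"
    by (intro poly_mapping_eqI) (simp add: lookup_sum)
  moreover obtain j where "j < card B" "v j \<noteq> 0" using v(1) by blast
  then have "\<beta> j \<in> B" "c (\<beta> j) \<noteq> 0" using bij_betwE[OF \<beta>] c by auto
  ultimately show ?thesis by blast
qed

lemma abelian_rank_eq_card:
  assumes G: "comm_group G" and h: "h \<in> iso G (free_Abelian_group R)" and R: "finite R"
  shows "abelian_rank G = card R"
proof -
  interpret G: comm_group G by fact
  interpret h: group_hom G "free_Abelian_group R" h
    using h by (simp add: group_hom_def group_hom_axioms_def iso_def)
  have inj: "inj_on h (carrier G)" and img: "h ` carrier G = carrier (free_Abelian_group R)"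
    using h by (auto simp: iso_def bij_betw_def)
  have keys: "Poly_Mapping.keys (h b) \<subseteq> R" if "b \<in> carrier G" for b
    using h.hom_closed[OF that] by simp
  have finprod: "h (finprod G f B) = (\<Sum>b\<in>B. h (f b))" if "finite B" "f \<in> B \<rightarrow> carrier G" for f B
    using that
  proof (induction B rule: finite_induct)
    case empty
    then show ?case using h.hom_one by simp
  next
    case (insert b B)
    then show ?case by (simp add: G.finprod_insert Pi_iff)
  qed
  \<comment> \<open>h turns a multiplicative relation in G into a linear one between chains, where
    coefficients can be compared.\<close>
  have comb: "finprod G (\<lambda>b. b [^]\<^bsub>G\<^esub> c b) B = \<one>\<^bsub>G\<^esub> \<longleftrightarrow> (\<Sum>b\<in>B. frag_cmul (c b) (h b)) = 0"
    if "finite B" "B \<subseteq> carrier G" for B and c :: "_ \<Rightarrow> int"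
  proof -
    let ?x = "finprod G (\<lambda>b. b [^]\<^bsub>G\<^esub> c b) B"
    have f: "(\<lambda>b. b [^]\<^bsub>G\<^esub> c b) \<in> B \<rightarrow> carrier G" using that by auto
    have "h ?x = (\<Sum>b\<in>B. h (b [^]\<^bsub>G\<^esub> c b))" by (rule finprod[OF that(1) f])
    also have "\<dots> = (\<Sum>b\<in>B. frag_cmul (c b) (h b))"
    proof (rule sum.cong[OF refl])
      fix b assume "b \<in> B"
      then have b: "b \<in> carrier G" using that by blast
      show "h (b [^]\<^bsub>G\<^esub> c b) = frag_cmul (c b) (h b)"
        using h.hom_int_pow[OF b] int_pow_free_Abelian_group[OF keys[OF b]] by simp
    qed
    finally have hx: "h ?x = (\<Sum>b\<in>B. frag_cmul (c b) (h b))" .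
    have "?x \<in> carrier G" using f by (rule G.finprod_closed)
    then have "?x = \<one>\<^bsub>G\<^esub> \<longleftrightarrow> h ?x = h \<one>\<^bsub>G\<^esub>"
      by (intro inj_on_eq_iff[OF inj _ G.one_closed, symmetric])
    then show ?thesis unfolding hx h.hom_one one_free_Abelian_group .
  qed
  let ?ind = "\<lambda>B. finite B \<and> B \<subseteq> carrier G \<and>
     (\<forall>c. finprod G (\<lambda>b. b [^]\<^bsub>G\<^esub> (c b :: int)) B = \<one>\<^bsub>G\<^esub> \<longrightarrow> (\<forall>b\<in>B. c b = 0))"
  have "card B \<le> card R" if "?ind B" for B
  proof (rule ccontr)
    assume "\<not> card B \<le> card R"
    then have "\<exists>c. (\<exists>b\<in>B. c b \<noteq> 0) \<and> (\<Sum>b\<in>B. frag_cmul (c b) (h b)) = 0"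
      by (intro frag_dependent[OF R]) (use that keys in auto)
    then obtain c where "\<exists>b\<in>B. c b \<noteq> 0" "(\<Sum>b\<in>B. frag_cmul (c b) (h b)) = 0" by blast
    then show False using that comb[of B c] by simp
  qed
  moreover have "\<exists>B. card R = card B \<and> ?ind B"
  proof -
    \<comment> \<open>The preimages of the free generators form an independent set that attains the
      bound.\<close>
    define g where "g x = inv_into (carrier G) h (frag_of x)" for x
    have g: "g x \<in> carrier G" "h (g x) = frag_of x" if "x \<in> R" for x
    proof -
      have "frag_of x \<in> h ` carrier G" using that by (simp add: img)
      then show "g x \<in> carrier G" "h (g x) = frag_of x"
        unfolding g_def by (auto intro: inv_into_into f_inv_into_f)
    qed
    have inj_g: "inj_on g R"
    proof (rule inj_onI)
      fix x y assume "x \<in> R" "y \<in> R" "g x = g y"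
      then have "frag_of x = frag_of y" using g(2) by metis
      then show "x = y" by (simp add: frag_of_eq)
    qed
    have "c (g x) = 0" if c: "finprod G (\<lambda>b. b [^]\<^bsub>G\<^esub> (c b :: int)) (g ` R) = \<one>\<^bsub>G\<^esub>" and x: "x \<in> R" for c x
    proof -
      have "(\<Sum>b\<in>g ` R. frag_cmul (c b) (h b)) = 0"
        using comb[of "g ` R" c] c R g(1) by (simp add: image_subset_iff)
      then have "(\<Sum>y\<in>R. frag_cmul (c (g y)) (frag_of y)) = 0"
        by (simp add: sum.reindex[OF inj_g] g(2))
      then have "Poly_Mapping.lookup (\<Sum>y\<in>R. frag_cmul (c (g y)) (frag_of y)) x = 0" by simp
      moreover have "Poly_Mapping.lookup (\<Sum>y\<in>R. frag_cmul (c (g y)) (frag_of y)) x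
          = (\<Sum>y\<in>R. if y = x then c (g y) else 0)"
        unfolding lookup_sum by (rule sum.cong) (simp_all add: lookup_single when_def)
      ultimately show ?thesis using R x by simp
    qed
    then have "?ind (g ` R)" using R g(1) by auto
    moreover have "card R = card (g ` R)" by (rule card_image[OF inj_g, symmetric])
    ultimately show ?thesis by blast
  qed
  ultimately show ?thesis
    unfolding abelian_rank_def by (intro cSup_eq_maximum) auto
qed

section \<open>Boundaries, restrictions and cones of integral chains\<close>

lemma lookup_bdry_chain_of:
  assumes "finite F"
  shows "Poly_Mapping.lookup (bdry_chain (frag_of F)) G = incidence G F"
proof -
  have "Poly_Mapping.lookup (bdry_chain (frag_of F)) G = (\<Sum>j\<in>F. if F - {j} = G then eps j F else 0)"
    unfolding bdry_chain_def frag_extend_of lookup_sum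
    by (rule sum.cong) (simp_all add: lookup_single when_def)
  then show ?thesis
    using assms by (simp add: incidence_def sum.inter_filter)
qed

lemma lookup_bdry_chain:
  assumes A: "finite A" "\<And>F. F \<in> A \<Longrightarrow> finite F" and c: "Poly_Mapping.keys c \<subseteq> A"
  shows "Poly_Mapping.lookup (bdry_chain c) G = (\<Sum>F\<in>A. Poly_Mapping.lookup c F * incidence G F)"
proof -
  have "bdry_chain c = (\<Sum>F\<in>Poly_Mapping.keys c. frag_cmul (Poly_Mapping.lookup c F) (bdry_chain (frag_of F)))"
    unfolding bdry_chain_def frag_extend_of by (simp only: frag_extend_def)
  then have "Poly_Mapping.lookup (bdry_chain c) G
      = (\<Sum>F\<in>Poly_Mapping.keys c. Poly_Mapping.lookup c F * Poly_Mapping.lookup (bdry_chain (frag_of F)) G)"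
    by (simp add: lookup_sum)
  also have "\<dots> = (\<Sum>F\<in>Poly_Mapping.keys c. Poly_Mapping.lookup c F * incidence G F)"
    by (rule sum.cong) (use A c lookup_bdry_chain_of in auto)
  also have "\<dots> = (\<Sum>F\<in>A. Poly_Mapping.lookup c F * incidence G F)"
    by (rule sum.mono_neutral_left) (use A c in \<open>auto simp: in_keys_iff\<close>)
  finally show ?thesis .
qed

lemma bdry_chain_add: "bdry_chain (a + b) = bdry_chain a + bdry_chain b"
  and bdry_chain_diff: "bdry_chain (a - b) = bdry_chain a - bdry_chain b"
  and bdry_chain_minus: "bdry_chain (- a) = - bdry_chain a"
  and bdry_chain_0 [simp]: "bdry_chain 0 = 0"
  by (simp_all add: bdry_chain_def frag_extend_add frag_extend_diff frag_extend_minus)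

definition restrict_chain :: "int set set \<Rightarrow> (int set \<Rightarrow>\<^sub>0 int) \<Rightarrow> (int set \<Rightarrow>\<^sub>0 int)" where
  "restrict_chain R = frag_extend (\<lambda>G. if G \<in> R then frag_of G else 0)"

lemma lookup_restrict_chain:
  "Poly_Mapping.lookup (restrict_chain R c) G = (if G \<in> R then Poly_Mapping.lookup c G else 0)"
proof -
  have "Poly_Mapping.lookup (restrict_chain R c) G
      = (\<Sum>H\<in>Poly_Mapping.keys c. if H = G then (if G \<in> R then Poly_Mapping.lookup c G else 0) else 0)"
    unfolding restrict_chain_def frag_extend_def lookup_sum
    by (rule sum.cong) (auto simp: lookup_single when_def)
  then show ?thesis by (simp add: in_keys_iff)
qed

text \<open>The cone with apex q over the part of c supported on A.\<close>

definition cone_chain :: "int \<Rightarrow> int set set \<Rightarrow> (int set \<Rightarrow>\<^sub>0 int) \<Rightarrow> (int set \<Rightarrow>\<^sub>0 int)" where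
  "cone_chain q A c = (\<Sum>G\<in>A. frag_cmul (Poly_Mapping.lookup c G) (frag_of (insert q G)))"

lemma lookup_bdry_cone_chain:
  assumes "finite A" "\<And>G. G \<in> A \<Longrightarrow> finite G"
  shows "Poly_Mapping.lookup (bdry_chain (cone_chain q A c)) H
    = (\<Sum>G\<in>A. Poly_Mapping.lookup c G * incidence H (insert q G))"
proof -
  have "bdry_chain (cone_chain q A c)
      = (\<Sum>G\<in>A. frag_cmul (Poly_Mapping.lookup c G) (bdry_chain (frag_of (insert q G))))"
    unfolding bdry_chain_def cone_chain_def frag_extend_sum[OF assms(1)] comp_def frag_extend_cmul ..
  then show ?thesis
    using assms(2) by (simp add: lookup_sum lookup_bdry_chain_of)
qed

text \<open>A set without q arises in the boundary of q \<union> G only by removing q, which has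
  sign +1. Away from q, the boundary of a cone is its base.\<close>

lemma lookup_bdry_cone_chain_base:
  assumes A: "finite A" "\<And>G. G \<in> A \<Longrightarrow> finite G \<and> (\<forall>x\<in>G. q < x)" and H: "q \<notin> H"
  shows "Poly_Mapping.lookup (bdry_chain (cone_chain q A c)) H = (if H \<in> A then Poly_Mapping.lookup c H else 0)"
proof -
  have "incidence H (insert q G) = (if G = H then 1 else 0)" if "G \<in> A" for G
  proof (cases "G = H")
    case True
    then show ?thesis using incidence_insert_min[of G q] A(2)[OF that] by simp
  next
    case False
    have "q \<notin> G" using A(2)[OF that] by blast
    have "incidence H (insert q G) = 0"
    proof (rule incidence_eq_0)
      fix j assume "j \<in> insert q G"
      show "insert q G - {j} \<noteq> H"
      proof (cases "j = q")
        case True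
        then have "insert q G - {j} = G" using \<open>q \<notin> G\<close> by blast
        then show ?thesis using False by simp
      next
        case False
        then have "q \<in> insert q G - {j}" by blast
        then show ?thesis using H by metis
      qed
    qed
    then show ?thesis using False by simp
  qed
  moreover have "Poly_Mapping.lookup (bdry_chain (cone_chain q A c)) H
      = (\<Sum>G\<in>A. Poly_Mapping.lookup c G * incidence H (insert q G))"
    by (rule lookup_bdry_cone_chain) (use A in auto)
  ultimately have "Poly_Mapping.lookup (bdry_chain (cone_chain q A c)) H
      = (\<Sum>G\<in>A. if G = H then Poly_Mapping.lookup c H else 0)"
    by (auto intro!: sum.cong)
  then show ?thesis using A(1) by simp
qed

text \<open>Phrased for families instead of a complex, because it also serves for cones that do not
  belong to the complex.\<close>

lemma bdry_chain_bdry_chain: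
  assumes L: "finite \<L>" "\<And>G. G \<in> \<L> \<Longrightarrow> finite G"
    and D: "finite \<D>" "\<And>F. F \<in> \<D> \<Longrightarrow> finite F" "facets \<D> \<subseteq> \<L>"
    and b: "Poly_Mapping.keys b \<subseteq> \<D>"
  shows "Poly_Mapping.keys (bdry_chain b) \<subseteq> \<L>" "bdry_chain (bdry_chain b) = 0"
proof -
  have lookup_b: "Poly_Mapping.lookup (bdry_chain b) G = (\<Sum>F\<in>\<D>. Poly_Mapping.lookup b F * incidence G F)" for G
    by (rule lookup_bdry_chain) (use D b in auto)
  show keys: "Poly_Mapping.keys (bdry_chain b) \<subseteq> \<L>"
  proof
    fix G assume "G \<in> Poly_Mapping.keys (bdry_chain b)"
    then have "(\<Sum>F\<in>\<D>. Poly_Mapping.lookup b F * incidence G F) \<noteq> 0"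
      unfolding in_keys_iff lookup_b .
    then obtain F where "F \<in> \<D>" "incidence G F \<noteq> 0"
      by (metis (no_types, lifting) mult_zero_right sum.neutral)
    then have "G \<in> facets \<D>" using incidence_eq_0[of F G] by (auto simp: facets_def)
    then show "G \<in> \<L>" using D by blast
  qed
  show "bdry_chain (bdry_chain b) = 0"
  proof (rule poly_mapping_eqI)
    fix H
    have "Poly_Mapping.lookup (bdry_chain (bdry_chain b)) H
        = (\<Sum>G\<in>\<L>. Poly_Mapping.lookup (bdry_chain b) G * incidence H G)"
      by (rule lookup_bdry_chain) (use L keys in auto)
    also have "\<dots> = (\<Sum>G\<in>\<L>. \<Sum>F\<in>\<D>. Poly_Mapping.lookup b F * (incidence H G * incidence G F))"
      unfolding lookup_b by (simp add: sum_distrib_left sum_distrib_right mult_ac)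
    also have "\<dots> = (\<Sum>F\<in>\<D>. Poly_Mapping.lookup b F * (\<Sum>G\<in>\<L>. incidence H G * incidence G F))"
      by (subst sum.swap) (simp add: sum_distrib_left)
    also have "\<dots> = 0"
    proof (intro sum.neutral ballI)
      fix F assume F: "F \<in> \<D>"
      have "(\<Sum>G\<in>\<L>. incidence H G * incidence G F) = 0"
      proof (rule sum_incidence_incidence)
        show "F - {j} \<in> \<L>" if "j \<in> F" for j
          by (rule subsetD[OF D(3)]) (use F that in \<open>unfold facets_def, blast\<close>)
      qed (use F L D in auto)
      then show "Poly_Mapping.lookup b F * (\<Sum>G\<in>\<L>. incidence H G * incidence G F) = 0" by simp
    qed
    finally show "Poly_Mapping.lookup (bdry_chain (bdry_chain b)) H = Poly_Mapping.lookup 0 H" by simp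
  qed
qed


text \<open>Cones with apex q do all the work. Those over R are not in \<D>, but their boundaries
  are cycles on \<L> with prescribed values on R. Those over A are in \<D> and reduce a cycle that
  vanishes on R to zero. The isomorphism theorem then applies to the restriction to R.\<close>

theorem betti_shifted:
  assumes L: "faces \<Delta> k = \<L>" "shifted_family q m \<L>"
    and D: "faces \<Delta> (k + 1) = \<D>" "shifted_family q (Suc m) \<D>"
    and facets: "facets \<D> \<subseteq> \<L>"
  shows "betti \<Delta> k = card (homology_faces q \<L> \<D>)"
proof -
  let ?C = "free_Abelian_group \<L>" and ?Z = "cycle_group \<Delta> k"
  define Zs where "Zs = {c \<in> carrier ?C. bdry_chain c = 0}"
  define R where "R = homology_faces q \<L> \<D>"
  define A where "A = {G \<in> \<L>. q \<notin> G \<and> insert q G \<in> \<D>}"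
  note Lf = shifted_familyD[OF L(2)] and Df = shifted_familyD[OF D(2)]
  have fin: "finite \<L>" "finite \<D>" using L D by (simp_all add: shifted_family_def)
  have RL: "R \<subseteq> \<L>" "finite R" and AL: "A \<subseteq> \<L>" "finite A"
    using fin by (auto simp: R_def A_def homology_faces_def)
  have above: "finite G \<and> (\<forall>x\<in>G. q < x)" if "G \<in> \<L>" "q \<notin> G" for G
  proof (intro conjI ballI)
    show "finite G" by (rule Lf(1)[OF that(1)])
    show "q < x" if "x \<in> G" for x
      using Lf(3)[OF \<open>G \<in> \<L>\<close> that] \<open>q \<notin> G\<close> that by (cases "x = q") auto
  qed
  have R: "finite G \<and> (\<forall>x\<in>G. q < x)" if "G \<in> R" for G
    by (rule above) (use that in \<open>auto simp: R_def homology_faces_def\<close>)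
  have A: "finite G \<and> (\<forall>x\<in>G. q < x)" if "G \<in> A" for G
    by (rule above) (use that in \<open>auto simp: A_def\<close>)
  have sub: "subgroup Zs ?C"
  proof
    show "Zs \<subseteq> carrier ?C" by (auto simp: Zs_def)
    show "x \<otimes>\<^bsub>?C\<^esub> y \<in> Zs" if "x \<in> Zs" "y \<in> Zs" for x y
      using that keys_add[of x y] by (auto simp: Zs_def bdry_chain_add)
    show "\<one>\<^bsub>?C\<^esub> \<in> Zs" by (simp add: Zs_def)
    show "inv\<^bsub>?C\<^esub> x \<in> Zs" if "x \<in> Zs" for x
      using that by (simp add: Zs_def bdry_chain_minus)
  qed
  have Z: "?Z = subgroup_generated ?C Zs"
    by (simp add: cycle_group_def L Zs_def)
  have carrier_Z: "carrier ?Z = Zs"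
    unfolding Z by (rule subgroup.carrier_subgroup_generated_subgroup[OF sub])
  have comm_Z: "comm_group ?Z"
    unfolding Z by (rule group.abelian_subgroup_generated[OF group_free_Abelian_group abelian_free_Abelian_group])
  interpret Z: comm_group ?Z by fact
  have mult_Z: "x \<otimes>\<^bsub>?Z\<^esub> y = x + y" for x y
    unfolding Z by simp
  have "restrict_chain R \<in> hom ?Z (free_Abelian_group R)"
  proof (rule homI)
    show "restrict_chain R c \<in> carrier (free_Abelian_group R)" for c
      by (auto simp: in_keys_iff lookup_restrict_chain split: if_splits)
    show "restrict_chain R (x \<otimes>\<^bsub>?Z\<^esub> y) = restrict_chain R x \<otimes>\<^bsub>free_Abelian_group R\<^esub> restrict_chain R y" for x y
      unfolding mult_Z by (simp add: restrict_chain_def frag_extend_add)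
  qed
  then interpret h: group_hom ?Z "free_Abelian_group R" "restrict_chain R"
    using Z.is_group by (simp add: group_hom_def group_hom_axioms_def)
  \<comment> \<open>The set q \<union> G is not in \<D>, but removing q from it gives G, and
    removing another j gives G with j exchanged for the smaller q. Both lie in \<L>.\<close>
  have cone_cycle: "bdry_chain (cone_chain q R c) \<in> Zs" for c
  proof -
    let ?D = "insert q ` R"
    have "Poly_Mapping.keys (cone_chain q R c) \<subseteq> ?D"
      using sum_closed_free_Abelian_group[of R "\<lambda>G. frag_cmul (Poly_Mapping.lookup c G) (frag_of (insert q G))" ?D]
        keys_cmul by (fastforce simp: cone_chain_def)
    moreover have "facets ?D \<subseteq> \<L>"
    proof
      fix H assume "H \<in> facets ?D"
      then obtain G j where G: "G \<in> R" "j \<in> insert q G" "H = insert q G - {j}"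
        by (auto simp: facets_def)
      have G': "G \<in> \<L>" "q \<notin> G" using G(1) by (auto simp: R_def homology_faces_def)
      show "H \<in> \<L>"
      proof (cases "j = q")
        case True
        then have "H = G" using G(3) G'(2) by blast
        then show ?thesis using G'(1) by simp
      next
        case False
        then have j: "j \<in> G" "q < j" using G(2) R[OF G(1)] by auto
        have "insert q (G - {j}) \<in> \<L>" by (rule Lf(4)[OF G'(1)]) (use j G' in auto)
        moreover have "H = insert q (G - {j})" using G(3) False by blast
        ultimately show ?thesis by simp
      qed
    qed
    moreover have finD: "finite F" if "F \<in> ?D" for F using that R by auto
    moreover have "finite ?D" using RL(2) by simp
    ultimately have "Poly_Mapping.keys (bdry_chain (cone_chain q R c)) \<subseteq> \<L>
        \<and> bdry_chain (bdry_chain (cone_chain q R c)) = 0"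
      by (intro conjI bdry_chain_bdry_chain[of \<L> ?D] fin Lf(1) finD)
    then show ?thesis by (simp add: Zs_def)
  qed
  have img: "restrict_chain R ` carrier ?Z = carrier (free_Abelian_group R)"
  proof
    show "restrict_chain R ` carrier ?Z \<subseteq> carrier (free_Abelian_group R)"
      using h.hom_closed by blast
    show "carrier (free_Abelian_group R) \<subseteq> restrict_chain R ` carrier ?Z"
    proof
      fix c assume "c \<in> carrier (free_Abelian_group R)"
      then have c: "Poly_Mapping.keys c \<subseteq> R" by simp
      have "restrict_chain R (bdry_chain (cone_chain q R c)) = c"
      proof (rule poly_mapping_eqI)
        fix G
        show "Poly_Mapping.lookup (restrict_chain R (bdry_chain (cone_chain q R c))) G = Poly_Mapping.lookup c G"
        proof (cases "G \<in> R")
          case True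
          then have "q \<notin> G" using R by blast
          then have "Poly_Mapping.lookup (bdry_chain (cone_chain q R c)) G = (if G \<in> R then Poly_Mapping.lookup c G else 0)"
            by (intro lookup_bdry_cone_chain_base RL(2) R)
          then show ?thesis using True by (simp add: lookup_restrict_chain)
        next
          case False
          then have "Poly_Mapping.lookup c G = 0" using c by (meson in_keys_iff subsetD)
          then show ?thesis using False by (simp add: lookup_restrict_chain)
        qed
      qed
      then show "c \<in> restrict_chain R ` carrier ?Z"
        unfolding carrier_Z using cone_cycle by (metis image_eqI)
    qed
  qed
  have ker: "kernel ?Z (free_Abelian_group R) (restrict_chain R) = boundaries \<Delta> k"
  proof (intro equalityI subsetI)
    fix c assume "c \<in> kernel ?Z (free_Abelian_group R) (restrict_chain R)"
    then have c: "Poly_Mapping.keys c \<subseteq> \<L>" "bdry_chain c = 0" "restrict_chain R c = 0"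
      by (auto simp: kernel_def carrier_Z Zs_def)
    have cR: "Poly_Mapping.lookup c G = 0" if "G \<in> R" for G
      using lookup_restrict_chain[of R c G] c(3) that by simp
    \<comment> \<open>As c vanishes on R, its part without q is supported on A, the bases whose
      cones lie in \<D>.\<close>
    define b where "b = cone_chain q A c"
    have b: "Poly_Mapping.keys b \<subseteq> \<D>"
      using sum_closed_free_Abelian_group[of A "\<lambda>G. frag_cmul (Poly_Mapping.lookup c G) (frag_of (insert q G))" \<D>]
        keys_cmul by (fastforce simp: cone_chain_def b_def A_def)
    have bb: "Poly_Mapping.keys (bdry_chain b) \<subseteq> \<L>" "bdry_chain (bdry_chain b) = 0"
      using bdry_chain_bdry_chain[of \<L> \<D> b] fin Lf(1) Df(1) facets b by auto
    define e where "e = c - bdry_chain b"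
    have e: "Poly_Mapping.keys e \<subseteq> \<L>" "bdry_chain e = 0"
      using keys_diff[of c "bdry_chain b"] c bb by (auto simp: e_def bdry_chain_diff)
    have e0: "Poly_Mapping.lookup e G = 0" if G: "q \<notin> G" for G
    proof -
      have "Poly_Mapping.lookup (bdry_chain b) G = (if G \<in> A then Poly_Mapping.lookup c G else 0)"
        unfolding b_def by (intro lookup_bdry_cone_chain_base AL(2) A G)
      moreover have "Poly_Mapping.lookup c G = 0" if "G \<notin> A"
      proof (cases "G \<in> \<L>")
        case True
        then have "G \<in> R" using that G by (auto simp: R_def A_def homology_faces_def)
        then show ?thesis by (rule cR)
      next
        case False
        then show ?thesis using c(1) by (meson in_keys_iff subsetD)
      qed
      ultimately show ?thesis by (simp add: e_def lookup_minus)
    qed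
    \<comment> \<open>All sets in the support of e contain q. Removing q from G gives a set that no
      other member of the support has as a facet, so the coefficient of e at G is one of the
      boundary of e, which is zero.\<close>
    have "Poly_Mapping.lookup e G = 0" for G
    proof (cases "q \<in> G \<and> G \<in> \<L>")
      case True
      define H where "H = G - {q}"
      have H: "q \<notin> H" "insert q H = G" using True by (auto simp: H_def)
      have "Poly_Mapping.lookup (bdry_chain e) H = (\<Sum>F\<in>\<L>. Poly_Mapping.lookup e F * incidence H F)"
        by (rule lookup_bdry_chain) (use fin Lf(1) e in auto)
      also have "\<dots> = (\<Sum>F\<in>{G}. Poly_Mapping.lookup e F * incidence H F)"
      proof (rule sum.mono_neutral_right)
        show "\<forall>F\<in>\<L> - {G}. Poly_Mapping.lookup e F * incidence H F = 0"
        proof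
          fix F assume F: "F \<in> \<L> - {G}"
          show "Poly_Mapping.lookup e F * incidence H F = 0"
          proof (cases "q \<in> F")
            case True
            have "incidence H F = 0"
            proof (rule incidence_eq_0)
              fix j assume "j \<in> F"
              show "F - {j} \<noteq> H"
              proof
                assume FH: "F - {j} = H"
                then have "j = q" using H(1) True by blast
                then have "F = insert q H" using FH True by blast
                then show False using H(2) F by simp
              qed
            qed
            then show ?thesis by simp
          qed (simp add: e0)
        qed
      qed (use fin True in auto)
      also have "\<dots> = Poly_Mapping.lookup e G * incidence H (insert q H)"
        by (simp add: H(2))
      also have "incidence H (insert q H) = 1"
      proof (rule incidence_insert_min)
        fix x assume "x \<in> H"
        then have "x \<in> G" "x \<noteq> q" by (auto simp: H_def)
        then show "q < x" using Lf(3)[of G x] True by simp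
      qed
      finally show ?thesis using e(2) by simp
    next
      case False
      then show ?thesis
        using e0 e(1) by (meson in_keys_iff subsetD)
    qed
    then have "e = 0" by (intro poly_mapping_eqI) simp
    then have "c = bdry_chain b" by (simp add: e_def)
    then show "c \<in> boundaries \<Delta> k"
      using b by (auto simp: boundaries_def D(1))
  next
    fix c assume "c \<in> boundaries \<Delta> k"
    then obtain b where b: "Poly_Mapping.keys b \<subseteq> \<D>" "c = bdry_chain b"
      by (auto simp: boundaries_def D(1))
    have "c \<in> Zs"
      using bdry_chain_bdry_chain[of \<L> \<D> b] fin Lf(1) Df(1) facets b by (auto simp: Zs_def)
    \<comment> \<open>If G in R were F - {j} with F in \<D>, then j = q, or j could be exchanged for
      q; either way G \<union> q would be in \<D>.\<close>
    moreover have "Poly_Mapping.lookup c G = 0" if G: "G \<in> R" for G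
    proof -
      have G': "q \<notin> G" "insert q G \<notin> \<D>" using G by (auto simp: R_def homology_faces_def)
      have "incidence G F = 0" if F: "F \<in> \<D>" for F
      proof (rule incidence_eq_0)
        fix j assume j: "j \<in> F"
        show "F - {j} \<noteq> G"
        proof
          assume FG: "F - {j} = G"
          show False
          proof (cases "j = q")
            case True
            then have "insert q G = F" using FG j by blast
            then show False using F G'(2) by simp
          next
            case False
            then have "q \<notin> F" using FG G'(1) by blast
            moreover have "q < j" using Df(3)[OF F j] False by simp
            ultimately have "insert q (F - {j}) \<in> \<D>" by (intro Df(4)[OF F]) (use j in auto)
            then show False using FG G'(2) by simp
          qed
        qed
      qed
      moreover have "Poly_Mapping.lookup c G = (\<Sum>F\<in>\<D>. Poly_Mapping.lookup b F * incidence G F)"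
        unfolding b(2) by (rule lookup_bdry_chain) (use fin Df(1) b in auto)
      ultimately show ?thesis by simp
    qed
    then have "restrict_chain R c = 0"
      by (intro poly_mapping_eqI) (simp add: lookup_restrict_chain)
    ultimately show "c \<in> kernel ?Z (free_Abelian_group R) (restrict_chain R)"
      by (simp add: kernel_def carrier_Z)
  qed
  have "(\<lambda>M. the_elem (restrict_chain R ` M)) \<in> iso (reduced_homology \<Delta> k) (free_Abelian_group R)"
    using h.FactGroup_iso_set[OF img] by (simp add: reduced_homology_def ker)
  moreover have "comm_group (reduced_homology \<Delta> k)"
    unfolding reduced_homology_def ker[symmetric]
    by (rule Z.abelian_FactGroup) (rule h.subgroup_kernel)
  ultimately show ?thesis
    using abelian_rank_eq_card RL(2) by (simp add: betti_def R_def)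
qed

section \<open>Skeleta of shifted complexes\<close>

lemma finite_faces: "finite \<Omega> \<Longrightarrow> finite (faces \<Omega> i)"
  by (simp add: faces_def)

lemma face_list:
  assumes "finite \<Omega>"
  shows "distinct (face_list \<Omega> i)" "set (face_list \<Omega> i) = faces \<Omega> i"
proof -
  have "\<exists>Fs. distinct Fs \<and> set Fs = faces \<Omega> i"
    using finite_distinct_list[OF finite_faces[OF assms]] by blast
  then have "distinct (face_list \<Omega> i) \<and> set (face_list \<Omega> i) = faces \<Omega> i"
    unfolding face_list_def by (rule someI_ex)
  then show "distinct (face_list \<Omega> i)" "set (face_list \<Omega> i) = faces \<Omega> i" by auto
qed

lemma faces_le_cdim:
  assumes "finite \<Omega>" "F \<in> faces \<Omega> i"
  shows "i \<le> cdim \<Omega>"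
  using assms unfolding cdim_def faces_def by (auto intro: Max_ge)

lemma facets_faces:
  assumes "simplicial_complex \<Omega>"
  shows "facets (faces \<Omega> i) \<subseteq> faces \<Omega> (i - 1)"
proof
  fix G assume "G \<in> facets (faces \<Omega> i)"
  then obtain F j where F: "F \<in> \<Omega>" "int (card F) - 1 = i" "j \<in> F" "G = F - {j}"
    by (auto simp: facets_def faces_def)
  have fin: "finite F" and "G \<in> \<Omega>"
    using assms F unfolding simplicial_complex_def by blast+
  moreover have "card F = Suc (card G)"
    unfolding F(4) using card_Suc_Diff1[OF fin F(3)] by simp
  ultimately show "G \<in> faces \<Omega> (i - 1)" using F(2) by (simp add: faces_def)
qed

lemma bdry_coeff_eq_wcoeff:
  assumes "i \<le> cdim \<Omega>"
  shows "bdry_coeff \<Omega> i G F = (uparrow ^^ nat (cdim \<Omega> - i)) (wcoeff G F)"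
proof -
  let ?n = "nat (cdim \<Omega> - i)"
  interpret field_hom "uparrow ^^ ?n" by (rule field_hom_uparrow_funpow)
  \<comment> \<open>For i beyond the dimension both exponents would be truncated to 0 and the
    denominator would lose its extra shift.\<close>
  have n: "nat (cdim \<Omega> - i + 1) = Suc ?n" using assms by simp
  have "bdry_coeff \<Omega> i G F = (\<Sum>j | j \<in> F \<and> F - {j} = G. of_int (eps j F)
      * (uparrow ^^ ?n) (xm (mset_set F) / uparrow (xm (mset_set G))))"
    unfolding bdry_coeff_def n
    by (rule sum.cong) (auto simp: hom_div funpow_swap1)
  also have "\<dots> = of_int (incidence G F) * (uparrow ^^ ?n) (xm (mset_set F) / uparrow (xm (mset_set G)))"
    by (simp add: incidence_def sum_distrib_right)
  finally show ?thesis
    unfolding wcoeff_def by (simp only: hom_mult hom_of_int)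
qed

text \<open>The iterated shift followed by the embedding into the closure is a ring homomorphism, so
  it carries the eigenvalues of the unshifted Laplacian to those of the weighted one.\<close>

lemma nonzero_part_Sud:
  assumes \<Omega>: "simplicial_complex \<Omega>" "finite \<Omega>" and V: "has_spectrum (faces \<Omega> i) V"
  shows "nonzero_part (Sud \<Omega> (i - 1))
    = nonzero_part (image_mset (\<lambda>v. to_ac ((uparrow ^^ nat (cdim \<Omega> - i)) v)) V)"
proof -
  let ?n = "nat (cdim \<Omega> - i)" and ?gs = "face_list \<Omega> (i - 1)" and ?fs = "face_list \<Omega> i"
  let ?\<phi> = "\<lambda>v. to_ac ((uparrow ^^ ?n) v)"
  define w where "w = wmat ?gs ?fs"
  interpret field_hom "uparrow ^^ ?n" by (rule field_hom_uparrow_funpow)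
  interpret \<phi>: comm_ring_hom ?\<phi>
    by unfold_locales (simp_all add: hom_add hom_mult)
  note gs = face_list[OF \<Omega>(2), of "i - 1"] and fs = face_list[OF \<Omega>(2), of i]
  have w: "w \<in> carrier_mat (length ?gs) (length ?fs)" by (simp add: w_def)
  have "bdry_mat \<Omega> i = map_mat (uparrow ^^ ?n) w"
  proof (rule eq_matI)
    fix r c assume "r < dim_row (map_mat (uparrow ^^ ?n) w)" "c < dim_col (map_mat (uparrow ^^ ?n) w)"
    then have rc: "r < length ?gs" "c < length ?fs" by (simp_all add: w_def)
    \<comment> \<open>An entry of the matrix exhibits an i-face, which bounds i by the dimension;
      without i-faces there is no column to compare.\<close>
    have "?fs ! c \<in> faces \<Omega> i" using rc fs(2) nth_mem by blast
    then have "i \<le> cdim \<Omega>" by (rule faces_le_cdim[OF \<Omega>(2)])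
    then show "bdry_mat \<Omega> i $$ (r, c) = map_mat (uparrow ^^ ?n) w $$ (r, c)"
      using rc by (simp add: bdry_mat_def w_def wmat_def bdry_coeff_eq_wcoeff)
  qed (simp_all add: bdry_mat_def w_def)
  then have "Lud \<Omega> (i - 1) = map_mat (uparrow ^^ ?n) w * map_mat (uparrow ^^ ?n) (w\<^sup>T)"
    by (simp add: Lud_def map_mat_transpose)
  also have "\<dots> = map_mat (uparrow ^^ ?n) (w * w\<^sup>T)"
    using w by (intro mat_hom_mult[symmetric]) auto
  finally have L: "map_mat to_ac (Lud \<Omega> (i - 1)) = map_mat ?\<phi> (w * w\<^sup>T)"
    by (auto intro!: eq_matI)
  have ww: "w * w\<^sup>T \<in> carrier_mat (length ?gs) (length ?gs)" using w by auto
  have "spectral (w * w\<^sup>T) V"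
    unfolding w_def by (rule has_spectrumD[OF V]) (use gs fs facets_faces[OF \<Omega>(1)] in auto)
  then have "spectral (map_mat ?\<phi> (w * w\<^sup>T)) (image_mset ?\<phi> V)"
    by (rule spectral_map_mat[OF \<phi>.comm_ring_hom_axioms ww])
  then show ?thesis
    unfolding Sud_def L using ww by (intro nonzero_part_proots[of _ "length ?gs"]) auto
qed

lemma shifted_complex_finite:
  assumes "shifted_complex \<Sigma>"
  shows "finite \<Sigma>"
proof -
  obtain p q where "vertices \<Sigma> = {p..q}" and S: "simplicial_complex \<Sigma>"
    using assms by (auto simp: shifted_complex_def)
  have "\<Sigma> \<subseteq> Pow (vertices \<Sigma>)"
    using S by (auto simp: simplicial_complex_def vertices_def)
  then show ?thesis
    using \<open>vertices \<Sigma> = {p..q}\<close> by (simp add: finite_subset)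
qed

lemma cdim_le:
  assumes "finite \<Omega>" "\<Omega> \<noteq> {}" "\<And>F. F \<in> \<Omega> \<Longrightarrow> int (card F) - 1 \<le> i"
  shows "cdim \<Omega> \<le> i"
  unfolding cdim_def by (rule Max.boundedI) (use assms in auto)

lemma simplicial_complexD:
  assumes "simplicial_complex \<Omega>"
  shows "{} \<in> \<Omega>" "\<And>F. F \<in> \<Omega> \<Longrightarrow> finite F" "\<And>F G. F \<in> \<Omega> \<Longrightarrow> G \<subseteq> F \<Longrightarrow> G \<in> \<Omega>"
  using assms by (auto simp: simplicial_complex_def)

lemma faces_nonempty:
  assumes S: "simplicial_complex \<Omega>" "finite \<Omega>" and i: "0 \<le> i" "i \<le> cdim \<Omega>"
  shows "faces \<Omega> i \<noteq> {}"
proof -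
  note D = simplicial_complexD[OF S(1)]
  have "cdim \<Omega> \<in> (\<lambda>F. int (card F) - 1) ` \<Omega>"
    unfolding cdim_def by (rule Max_in) (use S D in auto)
  then obtain F where F: "F \<in> \<Omega>" "cdim \<Omega> = int (card F) - 1" by blast
  have "nat (i + 1) \<le> card F" using i F(2) by simp
  then obtain G where G: "G \<subseteq> F" "card G = nat (i + 1)"
    by (rule obtain_subset_with_card_n)
  have "G \<in> faces \<Omega> i"
    using G D(3)[OF F(1) G(1)] i by (simp add: faces_def)
  then show ?thesis by blast
qed

text \<open>The passage from complexes to families. The (i-1)-faces of the deletion and of the link
  coincide, which is why one family provides the rows for the deletion and the columns for the
  link.\<close>

lemma shifted_complex_skeleton:
  fixes \<Sigma> :: "int set set" and i :: int
  assumes \<Sigma>: "shifted_complex \<Sigma>" and i: "0 \<le> i" "i \<le> cdim \<Sigma>"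
  defines "K \<equiv> pure_skel \<Sigma> i"
  defines "p \<equiv> initial_vertex K"
  shows "shifted_family p (Suc (nat i)) (faces \<Sigma> i)"
    and "simplicial_complex (del p K)" "finite (del p K)" "cdim (del p K) \<le> i"
    and "faces (del p K) i = avoiding p (faces \<Sigma> i)"
    and "faces (del p K) (i - 1) = star_base p (faces \<Sigma> i)"
    and "simplicial_complex (link p K)" "finite (link p K)" "cdim (link p K) \<le> i - 1"
    and "faces (link p K) (i - 1) = star_base p (faces \<Sigma> i)"
proof -
  let ?F = "faces \<Sigma> i"
  have S: "simplicial_complex \<Sigma>" using \<Sigma> by (simp add: shifted_complex_def)
  note D = simplicial_complexD[OF S] and fin = shifted_complex_finite[OF \<Sigma>]
  obtain a b where ab: "vertices \<Sigma> = {a..b}" and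
    shift: "\<forall>i\<in>{a..b}. \<forall>j\<in>{a..b}. \<forall>F\<in>\<Sigma>. i < j \<longrightarrow> i \<notin> F \<longrightarrow> j \<in> F \<longrightarrow> (F - {j}) \<union> {i} \<in> \<Sigma>"
    using \<Sigma> unfolding shifted_complex_def by (elim conjE exE)
  have card_F: "card F = Suc (nat i)" if "F \<in> ?F" for F
    using that i by (auto simp: faces_def)
  have fin_F: "finite F" if "F \<in> ?F" for F using that D(2) by (auto simp: faces_def)
  have K_sub: "K \<subseteq> \<Sigma>" using D(3) by (auto simp: K_def pure_skel_def faces_def)
  have F_K: "?F \<subseteq> K" by (auto simp: K_def pure_skel_def)
  have K_down: "G \<in> K" if "F \<in> K" "G \<subseteq> F" for F G
    using that unfolding K_def pure_skel_def by blast
  have fin_K: "finite K" using K_sub fin by (rule finite_subset)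
  obtain F0 where F0: "F0 \<in> ?F" using faces_nonempty[OF S fin i] by blast
  then obtain v0 where v0: "v0 \<in> F0" using card_F[OF F0] by fastforce
  have vert: "x \<in> vertices K" if "F \<in> K" "x \<in> F" for F x
    using K_down[of F "{x}"] that by (simp add: vertices_def)
  have vert_sub: "vertices K \<subseteq> {a..b}" using K_sub ab by (auto simp: vertices_def)
  then have fin_vert: "finite (vertices K)" by (rule finite_subset) simp
  have "p \<in> vertices K"
    unfolding p_def initial_vertex_def using fin_vert vert[of F0 v0] F0 F_K v0 by (intro Min_in) auto
  then have pK: "{p} \<in> K" "p \<in> {a..b}" using vert_sub by (auto simp: vertices_def)
  have p_le: "p \<le> x" if "F \<in> K" "x \<in> F" for F x
    unfolding p_def initial_vertex_def using fin_vert vert[OF that] by (rule Min_le)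
  show sf: "shifted_family p (Suc (nat i)) ?F"
    unfolding shifted_family_def
  proof (intro conjI ballI allI impI)
    show "finite ?F" using fin by (rule finite_faces)
    fix F assume F: "F \<in> ?F"
    show "finite F" "card F = Suc (nat i)" by (fact fin_F[OF F] card_F[OF F])+
    show "p \<le> x" if "x \<in> F" for x using p_le that F F_K by blast
    fix k j assume kj: "p \<le> k" "k < j" "k \<notin> F" "j \<in> F"
    have "j \<in> {a..b}" using vert[of F j] vert_sub F F_K kj(4) by blast
    moreover from this have "k \<in> {a..b}" using kj pK(2) by simp
    moreover have "F \<in> \<Sigma>" using F by (simp add: faces_def)
    ultimately have "(F - {j}) \<union> {k} \<in> \<Sigma>"
      using bspec[OF bspec[OF bspec[OF shift]], of k j F] kj(2-4) by simp
    then have "insert k (F - {j}) \<in> \<Sigma>" by simp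
    moreover have "card (insert k (F - {j})) = card F"
      using kj(3) fin_F[OF F] card_Suc_Diff1[OF fin_F[OF F] kj(4)] by simp
    ultimately show "insert k (F - {j}) \<in> ?F" using F by (simp add: faces_def)
  qed
  have K_card: "int (card F) - 1 \<le> i" if "F \<in> K" for F
  proof -
    obtain G where G: "G \<in> ?F" "F \<subseteq> G" using \<open>F \<in> K\<close> by (auto simp: K_def pure_skel_def)
    then show ?thesis using card_mono[OF fin_F[OF G(1)] G(2)] card_F[OF G(1)] i by simp
  qed
  have faces_K: "faces K i = ?F"
    using K_sub F_K by (auto simp: faces_def)
  have empty_K: "{} \<in> K" using K_down[OF pK(1)] by simp
  show del: "simplicial_complex (del p K)"
    unfolding simplicial_complex_def del_def using empty_K K_down K_sub D(2) by auto
  show "finite (del p K)" using fin_K by (simp add: del_def)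
  \<comment> \<open>Equality fails when p lies in every i-face; the bound already makes
    \<open>nat (cdim (del p K) - i)\<close> zero, so the eigenvalues are unshifted.\<close>
  show "cdim (del p K) \<le> i"
    by (rule cdim_le) (use fin_K empty_K K_card in \<open>auto simp: del_def\<close>)
  show "faces (del p K) i = avoiding p ?F"
    using faces_K by (auto simp: faces_def del_def avoiding_def)
  have link_sub: "link p K \<subseteq> K"
    using K_down by (auto simp: link_def)
  show "simplicial_complex (link p K)"
    unfolding simplicial_complex_def
  proof (intro conjI ballI allI impI)
    show "{} \<in> link p K" using pK(1) by (simp add: link_def)
    show "finite F" if "F \<in> link p K" for F using that link_sub K_sub D(2) by blast
    show "G \<in> link p K" if "F \<in> link p K" "G \<subseteq> F" for F G
      using that K_down[of "F \<union> {p}" "G \<union> {p}"] by (auto simp: link_def)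
  qed
  show "finite (link p K)" using link_sub fin_K by (rule finite_subset)
  have link_card: "finite F \<and> card (insert p F) = Suc (card F)" if "F \<in> link p K" for F
    using that link_sub K_sub D(2) by (auto simp: link_def)
  show "cdim (link p K) \<le> i - 1"
  proof (rule cdim_le)
    show "int (card F) - 1 \<le> i - 1" if "F \<in> link p K" for F
      using link_card[OF that] K_card[of "insert p F"] that by (simp add: link_def)
  qed (use pK(1) \<open>finite (link p K)\<close> in \<open>auto simp: link_def\<close>)
  show "faces (link p K) (i - 1) = star_base p ?F"
  proof (intro equalityI subsetI)
    fix G assume "G \<in> faces (link p K) (i - 1)"
    then have G: "G \<in> link p K" "int (card G) - 1 = i - 1" by (auto simp: faces_def)
    then have "insert p G \<in> faces K i" using link_card[OF G(1)] by (simp add: faces_def link_def)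
    then show "G \<in> star_base p ?F" using G(1) faces_K by (simp add: star_base_def link_def)
  next
    fix G assume "G \<in> star_base p ?F"
    then have G: "p \<notin> G" "insert p G \<in> ?F" by (auto simp: star_base_def)
    then have "G \<in> link p K" using F_K by (auto simp: link_def)
    moreover from this have "int (card G) - 1 = i - 1"
      using link_card card_F[OF G(2)] i by simp
    ultimately show "G \<in> faces (link p K) (i - 1)" by (simp add: faces_def)
  qed
  \<comment> \<open>Purity enters here: an (i-1)-face without p is F - {j} for some i-face F. Either
    F contains p, which forces j = p, or j can be exchanged for p.\<close>
  show "faces (del p K) (i - 1) = star_base p ?F"
  proof (intro equalityI subsetI)
    fix G assume "G \<in> faces (del p K) (i - 1)"
    then have G: "G \<in> K" "p \<notin> G" "int (card G) = i" by (auto simp: faces_def del_def)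
    then obtain F where F: "F \<in> ?F" "G \<subseteq> F" by (auto simp: K_def pure_skel_def)
    have "card (F - G) = 1"
      using card_Diff_subset[OF finite_subset[OF F(2) fin_F[OF F(1)]] F(2)] card_F[OF F(1)] G(3) by simp
    then obtain j where "F - G = {j}" by (auto simp: card_1_singleton_iff)
    then have j: "j \<in> F" "G = F - {j}" using F(2) by blast+
    show "G \<in> star_base p ?F"
    proof (cases "p \<in> F")
      case True
      then have "insert p G = F" using j G(2) by blast
      then show ?thesis using F(1) G(2) by (simp add: star_base_def)
    next
      case False
      then have "G \<in> facets (avoiding p ?F)" using F(1) j by (auto simp: facets_def avoiding_def)
      then show ?thesis using facets_avoiding[OF sf] by blast
    qed
  next
    fix G assume "G \<in> star_base p ?F"
    then have G: "p \<notin> G" "insert p G \<in> ?F" by (auto simp: star_base_def)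
    then have "G \<in> K" using F_K K_down[of "insert p G" G] by blast
    moreover have "int (card G) - 1 = i - 1"
      using fin_F[OF G(2)] card_F[OF G(2)] G(1) i by simp
    ultimately show "G \<in> faces (del p K) (i - 1)" using G(1) by (simp add: faces_def del_def)
  qed
qed

section \<open>From pairs (S,T) to the spectrum of the complex\<close>

lemma nonzero_part_Sud_zpolys:
  assumes "simplicial_complex \<Omega>" "finite \<Omega>" "has_spectrum (faces \<Omega> i) (zpolys P)"
    and P: "bounded_pairs p P" and n: "n = nat (cdim \<Omega> - i)"
  shows "nonzero_part (Sud \<Omega> (i - 1)) = image_mset (\<lambda>(S, T). z_ev n S T) P"
proof -
  interpret field_hom "uparrow ^^ n" by (rule field_hom_uparrow_funpow)
  have "nonzero_part (Sud \<Omega> (i - 1)) = nonzero_part (image_mset (\<lambda>v. to_ac ((uparrow ^^ n) v)) (zpolys P))"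
    unfolding n by (rule nonzero_part_Sud[OF assms(1-3)])
  also have "image_mset (\<lambda>v. to_ac ((uparrow ^^ n) v)) (zpolys P) = image_mset (\<lambda>(S, T). z_ev n S T) P"
    by (simp add: image_mset.compositionality comp_def z_ev_def case_prod_unfold)
  \<comment> \<open>Since T is nonempty and both the shift and the embedding are injective, no value
    is filtered out.\<close>
  also have "nonzero_part (image_mset (\<lambda>(S, T). z_ev n S T) P) = image_mset (\<lambda>(S, T). z_ev n S T) P"
    unfolding nonzero_part_def filter_mset_eq_conv
    using bounded_pairsD(1)[OF P] by (auto simp: z_ev_def zpoly_eq_0_iff)
  finally show ?thesis .
qed

lemma zpolys_eq_of_z_ev:
  assumes "image_mset (\<lambda>(S, T). z_ev 0 S T) P = image_mset (\<lambda>(S, T). z_ev 0 S T) P'"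
  shows "zpolys P = zpolys P'"
  using arg_cong[OF assms, of "image_mset of_ac"]
  by (simp add: image_mset.compositionality comp_def z_ev_def case_prod_unfold)

lemma bounded_pairs_transfer:
  assumes eq: "zpolys P = zpolys P'" and P': "bounded_pairs p P'"
  shows "bounded_pairs p P"
  unfolding bounded_pairs_def
proof (intro allI impI conjI ballI)
  fix S T assume "(S, T) \<in># P"
  then have "zpoly S T \<in># zpolys P" by force
  then obtain S' T' where ST': "(S', T') \<in># P'" "zpoly S T = zpoly S' T'"
    unfolding eq by auto
  note B = bounded_pairsD[OF P' ST'(1)]
  show T: "T \<noteq> {#}" using B(1) ST'(2) zpoly_eq_0_iff by metis
  have low: "p \<le> x" if "j \<in># T" "x \<in># add_mset j S" for j x
    by (rule zpoly_eq_imp_bounded_below[OF ST'(2) _ that]) (use B in auto)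
  fix x assume "x \<in># S + T"
  then consider "x \<in># S" | "x \<in># T" by auto
  then show "p \<le> x"
  proof cases
    case 1
    \<comment> \<open>S is visible only in the monomials of S \<union> j with j in T; T is nonempty
      because the value is nonzero.\<close>
    obtain j where "j \<in># T" using T by blast
    then show ?thesis using low 1 by simp
  next
    case 2
    then show ?thesis using low by simp
  qed
qed

text \<open>The sets in the recursion presuppose a choice of S and T for every eigenvalue.
  Quantifying over all P and Q that represent the nonzero eigenvalues with multiplicity makes the
  result independent of that choice. The complex with only the empty face has dimension -1, so no i
  satisfies 0 \<le> i \<le> d; the alternative in the assumption admits it.\<close>

theorem theorem8p2:
  fixes \<Sigma> :: "int set set" and d i :: int
  assumes "shifted_complex \<Sigma>" and "cdim \<Sigma> = d"
    and "0 \<le> i" and "i \<le> d \<or> vertices \<Sigma> = {}"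
  shows
    "(\<forall>ev\<in>#nonzero_part (Sud \<Sigma> (i - 1)). \<exists>S T. ev = z_ev (nat (d - i)) S T) \<and>
     (vertices \<Sigma> = {} \<longrightarrow> nonzero_part (Sud \<Sigma> (i - 1)) = {#}) \<and>
     (vertices \<Sigma> \<noteq> {} \<longrightarrow>
       (let p = initial_vertex (pure_skel \<Sigma> i);
            \<Delta> = del p (pure_skel \<Sigma> i);
            \<Lambda> = link p (pure_skel \<Sigma> i)
        in (\<forall>ev\<in>#nonzero_part (Sud \<Delta> (i - 1)). \<exists>S T. ev = z_ev 0 S T) \<and>
           (\<forall>ev\<in>#nonzero_part (Sud \<Lambda> (i - 2)). \<exists>S T. ev = z_ev 0 S T) \<and>
           (\<forall>P Q :: (int multiset \<times> int multiset) multiset.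
              image_mset (\<lambda>(S, T). z_ev 0 S T) P = nonzero_part (Sud \<Delta> (i - 1)) \<longrightarrow>
              image_mset (\<lambda>(S, T). z_ev 0 S T) Q = nonzero_part (Sud \<Lambda> (i - 2)) \<longrightarrow>
              Sud \<Sigma> (i - 1) \<doteq>\<^sub>0
                image_mset (\<lambda>(S, T). z_ev (nat (d - i)) S (add_mset p T)) P
                + image_mset (\<lambda>(S, T). z_ev (nat (d - i)) (add_mset p S) (add_mset p T)) Q
                + replicate_mset (betti \<Delta> (i - 1)) (z_ev (nat (d - i)) {#} {#p#}))))"
proof (cases "vertices \<Sigma> = {}")
  case True
  have S: "simplicial_complex \<Sigma>" using assms(1) by (simp add: shifted_complex_def)
  note fin = shifted_complex_finite[OF assms(1)]
  have empty: "F = {}" if "F \<in> \<Sigma>" for F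
    using simplicial_complexD(3)[OF S that] True by (force simp: vertices_def)
  have "F \<notin> faces \<Sigma> i" for F
    using empty[of F] assms(3) by (cases "F = {}") (auto simp: faces_def)
  then have "faces \<Sigma> i = {}" by blast
  then have "has_spectrum (faces \<Sigma> i) {#}"
    by (intro has_spectrum_trivial) (simp_all add: facets_def)
  then have "nonzero_part (Sud \<Sigma> (i - 1)) = {#}"
    using nonzero_part_Sud[OF S fin] by (simp add: nonzero_part_def)
  then show ?thesis using True by simp
next
  case False
  then have i: "0 \<le> i" "i \<le> cdim \<Sigma>" using assms by auto
  let ?n = "nat (d - i)" and ?F = "faces \<Sigma> i"
  define K p \<Delta> \<Lambda> where "K = pure_skel \<Sigma> i" and "p = initial_vertex K"
    and "\<Delta> = del p K" and "\<Lambda> = link p K"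
  have S: "simplicial_complex \<Sigma>" using assms(1) by (simp add: shifted_complex_def)
  note fin = shifted_complex_finite[OF assms(1)]
  note sk = shifted_complex_skeleton[OF assms(1) i, folded K_def, folded p_def, folded \<Delta>_def \<Lambda>_def]
  note sf = sk(1) and \<Delta> = sk(2-6) and \<Lambda> = sk(7-10)
  have spec_\<Sigma>: "nonzero_part (Sud \<Sigma> (i - 1)) = image_mset (\<lambda>(S, T). z_ev ?n S T) P"
    if "has_spectrum ?F (zpolys P)" "bounded_pairs p P" for P
    by (rule nonzero_part_Sud_zpolys[OF S fin that]) (simp add: assms(2))
  obtain P0 where P0: "has_spectrum ?F (zpolys P0)" "bounded_pairs p P0"
    using shifted_family_spectrum[OF sf] by blast
  \<comment> \<open>Deletion and link lie above p. The bound p + 1 is also the vertex through which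
    \<open>card_star_base\<close> counts and the apex of the cones in the homology.\<close>
  obtain P1 where P1: "has_spectrum (avoiding p ?F) (zpolys P1)" "bounded_pairs (p + 1) P1"
      "size P1 = card (containing (p + 1) (avoiding p ?F))"
    using shifted_family_spectrum[OF shifted_family_avoiding[OF sf]] by blast
  obtain Q1 where Q1: "has_spectrum (star_base p ?F) (zpolys Q1)" "bounded_pairs (p + 1) Q1"
      "size Q1 = card (containing (p + 1) (star_base p ?F))"
    using shifted_family_spectrum[OF shifted_family_star_base[OF sf]] by blast
  have spec_\<Delta>: "nonzero_part (Sud \<Delta> (i - 1)) = image_mset (\<lambda>(S, T). z_ev 0 S T) P1"
    by (rule nonzero_part_Sud_zpolys[OF \<Delta>(1,2) _ P1(2)]) (use P1(1) \<Delta>(3,4) in auto)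
  have "nonzero_part (Sud \<Lambda> (i - 1 - 1)) = image_mset (\<lambda>(S, T). z_ev 0 S T) Q1"
    by (rule nonzero_part_Sud_zpolys[OF \<Lambda>(1,2) _ Q1(2)]) (use Q1(1) \<Lambda>(3,4) in auto)
  then have spec_\<Lambda>: "nonzero_part (Sud \<Lambda> (i - 2)) = image_mset (\<lambda>(S, T). z_ev 0 S T) Q1"
    by (simp add: diff_diff_eq)
  have betti: "betti \<Delta> (i - 1) = card (homology_faces (p + 1) (star_base p ?F) (avoiding p ?F))"
    by (rule betti_shifted[OF \<Delta>(5) shifted_family_star_base[OF sf] _ shifted_family_avoiding[OF sf]
          facets_avoiding[OF sf]]) (simp add: \<Delta>(4))
  have main: "Sud \<Sigma> (i - 1) \<doteq>\<^sub>0 image_mset (\<lambda>(S, T). z_ev ?n S (add_mset p T)) P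
      + image_mset (\<lambda>(S, T). z_ev ?n (add_mset p S) (add_mset p T)) Q
      + replicate_mset (betti \<Delta> (i - 1)) (z_ev ?n {#} {#p#})"
    if P: "image_mset (\<lambda>(S, T). z_ev 0 S T) P = nonzero_part (Sud \<Delta> (i - 1))"
      and Q: "image_mset (\<lambda>(S, T). z_ev 0 S T) Q = nonzero_part (Sud \<Lambda> (i - 2))" for P Q
  proof -
    note P = P[unfolded spec_\<Delta>] and Q = Q[unfolded spec_\<Lambda>]
    have P': "zpolys P = zpolys P1" and Q': "zpolys Q = zpolys Q1"
      by (rule zpolys_eq_of_z_ev, fact)+
    have size: "size P = size P1" "size Q = size Q1"
      using P' Q' by (metis size_image_mset)+
    have bounded: "bounded_pairs p P" "bounded_pairs p Q"
      using bounded_pairs_transfer[OF P' P1(2)] bounded_pairs_transfer[OF Q' Q1(2)]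
      by (auto elim: bounded_pairs_mono)
    \<comment> \<open>P and Q have the sizes of P1 and Q1, so the faces of the link not accounted
      for are the homology faces.\<close>
    have card: "size P + size Q + betti \<Delta> (i - 1) = card (star_base p ?F)"
      using card_star_base[OF sf, of "p + 1"] P1(3) Q1(3) size betti by simp
    have "has_spectrum ?F (zpolys (cone_pairs p P Q (card (star_base p ?F) - size P - size Q)))"
      by (rule has_spectrum_cone_pairs[OF sf _ _ bounded]) (use P1(1) Q1(1) P' Q' card in auto)
    also have "card (star_base p ?F) - size P - size Q = betti \<Delta> (i - 1)"
      using card by simp
    finally have "nonzero_part (Sud \<Sigma> (i - 1))
        = image_mset (\<lambda>(S, T). z_ev ?n S T) (cone_pairs p P Q (betti \<Delta> (i - 1)))"
      by (rule spec_\<Sigma>[OF _ bounded_cone_pairs[OF bounded]])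
    then have N: "nonzero_part (Sud \<Sigma> (i - 1))
        = image_mset (\<lambda>(S, T). z_ev ?n S (add_mset p T)) P
          + image_mset (\<lambda>(S, T). z_ev ?n (add_mset p S) (add_mset p T)) Q
          + replicate_mset (betti \<Delta> (i - 1)) (z_ev ?n {#} {#p#})"
      by (simp add: cone_pairs_def image_mset.compositionality comp_def case_prod_unfold)
    \<comment> \<open>By N the right side already is a nonzero part, so taking the nonzero part
      again changes nothing.\<close>
    show ?thesis
      unfolding eq_upto_zero_def N[symmetric] by (simp add: nonzero_part_def filter_filter_mset)
  qed
  have "\<forall>ev\<in>#nonzero_part (Sud \<Sigma> (i - 1)). \<exists>S T. ev = z_ev ?n S T"
    unfolding spec_\<Sigma>[OF P0] by auto
  moreover have "\<forall>ev\<in>#nonzero_part (Sud \<Delta> (i - 1)). \<exists>S T. ev = z_ev 0 S T"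
    unfolding spec_\<Delta> by auto
  moreover have "\<forall>ev\<in>#nonzero_part (Sud \<Lambda> (i - 2)). \<exists>S T. ev = z_ev 0 S T"
    unfolding spec_\<Lambda> by auto
  ultimately show ?thesis
    using False main unfolding Let_def K_def[symmetric] p_def[symmetric] \<Delta>_def[symmetric] \<Lambda>_def[symmetric]
    by blast
qed

end
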